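(* Let $A$ be a $C^*$-algebra, let $X$ be a semi-inner product $C^*$-module over $A$, let $x_0,y_0,x_1,y_1\in X$, and let $(r_1,\dots,r_n)\in\mathbb{R}^n$ be a probability vector. Let $p\in A$ and $f=(f_1,\dots,f_n),\ g=(g_1,\dots,g_n)\in D_p(A,X^n)$ be such that $$\left\|Df(p)-\widehat{\frac{x_0+y_0}{2}}\right\|\le\left\|\frac{x_0-y_0}{2}\right\|\quad\text{and}\quad \left\|Dg(p)-\widehat{\frac{x_1+y_1}{2}}\right\|\le\left\|\frac{x_1-y_1}{2}\right\|.$$ Then for all $a\in A$, $$\left\|\sum_{i=1}^n r_i\big\langle Df_i(p)(a),Dg_i(p)(a)\big\rangle-\Big\langle\sum_{i=1}^n r_iDf_i(p)(a),\sum_{i=1}^n r_iDg_i(p)(a)\Big\rangle\right\|\le\frac14\|x_0-y_0\|\,\|x_1-y_1\|\,\|a\|^2.$$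
   Context: A semi-inner product $C^*$-module over a $C^*$-algebra $A$ is a right $A$-module $X$ with a map $\langle\cdot,\cdot\rangle:X\times X\to A$ such that (i) $\langle x,y+z\rangle=\langle x,y\rangle+\langle x,z\rangle$; (ii) $\langle x,ya\rangle=\langle x,y\rangle a$; (iii) $\langle x,y\rangle^*=\langle y,x\rangle$; (iv) $\langle x,x\rangle\ge 0$, for all $x,y,z\in X$, $a\in A$. The (semi)norm on $X$ is $\|x\|=\|\langle x,x\rangle\|^{1/2}$. $X^n$ is the direct sum module with $\langle (x_i),(y_i)\rangle=\sum_{i=1}^n\langle x_i,y_i\rangle$ and the corresponding (semi)norm. For $x\in X$, $\hat{x}:A\to X^n$ (also written $\widehat{x}$) is the map $\hat x(a)=(xa,\dots,xa)$, $a\in A$. Norms of bounded linear maps $A\to X^n$ are operator norms. For $Y=X$ or $X^n$, a function $f:A\to Y$ is Fréchet differentiable at $q\in A$ if there is a bounded linear map $u=Df(q):A\to Y$ with $\lim_{h\to0}\|f(q+h)-f(q)-u(h)\|/\|h\|=0$. $D_p(A,Y)$ denotes the set of all continuous functions $f:A\to Y$ that are Fréchet differentiable on an open neighborhood $U$ of $p$. A probability vector is a vector with nonnegative entries summing to $1$. *)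

theory Defs
  imports "HOL-Analysis.Analysis"
begin

class complex_vector = real_vector +
  fixes scaleC :: "complex \<Rightarrow> 'a \<Rightarrow> 'a"  (infixr "*\<^sub>C" 75)
  assumes scaleC_add_right: "c *\<^sub>C (x + y) = c *\<^sub>C x + c *\<^sub>C y"
    and scaleC_add_left: "(c + d) *\<^sub>C x = c *\<^sub>C x + d *\<^sub>C x"
    and scaleC_scaleC: "c *\<^sub>C d *\<^sub>C x = (c * d) *\<^sub>C x"
    and scaleR_scaleC: "r *\<^sub>R x = complex_of_real r *\<^sub>C x"

text \<open>Complex C*-algebras. No unit element is required.\<close>

class cstar_algebra = complex_vector + real_normed_algebra + banach +
  fixes star :: "'a \<Rightarrow> 'a"
  assumes mult_scaleC_left: "(c *\<^sub>C x) * y = c *\<^sub>C (x * y)"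
    and mult_scaleC_right: "x * (c *\<^sub>C y) = c *\<^sub>C (x * y)"
    and norm_scaleC: "norm (c *\<^sub>C x) = cmod c * norm x"
    and star_star: "star (star x) = x"
    and star_add: "star (x + y) = star x + star y"
    and star_scaleC: "star (c *\<^sub>C x) = cnj c *\<^sub>C star x"
    and star_mult: "star (x * y) = star y * star x"
    and cstar_identity: "norm (star x * x) = (norm x)\<^sup>2"

text \<open>The spectrum is taken in the unitization, whose elements \<open>a + \<alpha>1\<close> are written
  \<open>(a, \<alpha>)\<close>, so that it also makes sense without a unit. If the algebra has a unit, this adds
  at most the point 0 to the usual spectrum, which does not affect positivity.\<close>

definition unitization_mult :: "'a::cstar_algebra \<times> complex \<Rightarrow> 'a \<times> complex \<Rightarrow> 'a \<times> complex" where
  "unitization_mult x y =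
     (fst x * fst y + snd x *\<^sub>C fst y + snd y *\<^sub>C fst x, snd x * snd y)"

definition spectrum :: "'a::cstar_algebra \<Rightarrow> complex set" where
  "spectrum a = {l. \<not> (\<exists>y. unitization_mult (a, - l) y = (0, 1) \<and> unitization_mult y (a, - l) = (0, 1))}"

definition cstar_positive :: "'a::cstar_algebra \<Rightarrow> bool" where
  "cstar_positive a \<longleftrightarrow> star a = a \<and> spectrum a \<subseteq> complex_of_real ` {0..}"

text \<open>\<open>act x a\<close> is the right action \<open>xa\<close> and \<open>ip\<close> the semi-inner product. As usual, a module
  over a C*-algebra is a complex vector space with compatible scalar multiplication.
  Homogeneity of \<open>ip\<close> under complex scalars follows from the axioms.\<close>

locale semi_inner_product_module =
  fixes act :: "'x::complex_vector \<Rightarrow> 'a::cstar_algebra \<Rightarrow> 'x"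
    and ip :: "'x \<Rightarrow> 'x \<Rightarrow> 'a"
  assumes act_add_left: "act (x + y) a = act x a + act y a"
    and act_add_right: "act x (a + b) = act x a + act x b"
    and act_act: "act (act x a) b = act x (a * b)"
    and act_scaleC_left: "act (c *\<^sub>C x) a = c *\<^sub>C act x a"
    and act_scaleC_right: "act x (c *\<^sub>C a) = c *\<^sub>C act x a"
    and ip_add_right: "ip x (y + z) = ip x y + ip x z"
    and ip_act_right: "ip x (act y a) = ip x y * a"
    and ip_star: "star (ip x y) = ip y x"
    and ip_positive: "cstar_positive (ip x x)"

definition seminorm :: "('y \<Rightarrow> 'y \<Rightarrow> 'a::cstar_algebra) \<Rightarrow> 'y \<Rightarrow> real" where
  "seminorm ip y = sqrt (norm (ip y y))"

text \<open>The direct sum \<open>X^n\<close> is \<open>'x ^ 'n\<close>.\<close>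

instantiation vec :: (complex_vector, finite) complex_vector
begin

definition "c *\<^sub>C v = (\<chi> i. c *\<^sub>C (v $ i))"

instance
  by standard
    (simp_all add: scaleC_vec_def vec_eq_iff scaleC_add_right scaleC_add_left scaleC_scaleC
      scaleR_scaleC)

end

definition ip_vec :: "('x \<Rightarrow> 'x \<Rightarrow> 'a::cstar_algebra) \<Rightarrow> 'x ^ 'n::finite \<Rightarrow> 'x ^ 'n \<Rightarrow> 'a" where
  "ip_vec ip v w = (\<Sum>i\<in>UNIV. ip (v $ i) (w $ i))"

definition hat :: "('x \<Rightarrow> 'a \<Rightarrow> 'x) \<Rightarrow> 'x \<Rightarrow> 'a \<Rightarrow> 'x ^ 'n" where
  "hat act x a = (\<chi> i. act x a)"

text \<open>Below, \<open>ip\<close> is the semi-inner product of the codomain, which is \<open>X\<close> or \<open>X^n\<close>.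
  The codomain carries no type-class topology because its norm is only a seminorm.\<close>

definition bounded_clinear ::
    "('y \<Rightarrow> 'y \<Rightarrow> 'a::cstar_algebra) \<Rightarrow> ('a \<Rightarrow> 'y::complex_vector) \<Rightarrow> bool" where
  "bounded_clinear ip u \<longleftrightarrow>
     (\<forall>a b. u (a + b) = u a + u b) \<and> (\<forall>c a. u (c *\<^sub>C a) = c *\<^sub>C u a) \<and>
     (\<exists>K. \<forall>a. seminorm ip (u a) \<le> K * norm a)"

definition op_norm :: "('y \<Rightarrow> 'y \<Rightarrow> 'a::cstar_algebra) \<Rightarrow> ('a \<Rightarrow> 'y) \<Rightarrow> real" where
  "op_norm ip u = (SUP a\<in>cball 0 1. seminorm ip (u a))"

text \<open>A derivative is unique only up to elements of seminorm 0, so it is given as a relation.\<close>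

definition has_frechet_derivative ::
    "('y \<Rightarrow> 'y \<Rightarrow> 'a::cstar_algebra) \<Rightarrow> ('a \<Rightarrow> 'y::complex_vector) \<Rightarrow> 'a \<Rightarrow> ('a \<Rightarrow> 'y) \<Rightarrow> bool" where
  "has_frechet_derivative ip f q u \<longleftrightarrow> bounded_clinear ip u \<and>
     ((\<lambda>h. seminorm ip (f (q + h) - f q - u h) / norm h) \<longlongrightarrow> 0) (at 0)"

definition continuous_seminorm ::
    "('y \<Rightarrow> 'y \<Rightarrow> 'a::cstar_algebra) \<Rightarrow> ('a \<Rightarrow> 'y::complex_vector) \<Rightarrow> bool" where
  "continuous_seminorm ip f \<longleftrightarrow> (\<forall>q. ((\<lambda>b. seminorm ip (f b - f q)) \<longlongrightarrow> 0) (at q))"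

definition diff_near ::
    "('y \<Rightarrow> 'y \<Rightarrow> 'a::cstar_algebra) \<Rightarrow> 'a \<Rightarrow> ('a \<Rightarrow> 'y::complex_vector) set" where
  "diff_near ip p = {f. continuous_seminorm ip f \<and>
     (\<exists>U. open U \<and> p \<in> U \<and> (\<forall>q\<in>U. \<exists>u. has_frechet_derivative ip f q u))}"

definition probability_vector :: "real ^ 'n::finite \<Rightarrow> bool" where
  "probability_vector r \<longleftrightarrow> (\<forall>i. 0 \<le> r $ i) \<and> (\<Sum>i\<in>UNIV. r $ i) = 1"

end

theory Submission
  imports Defs
begin

text \<open>For a probability vector \<open>r\<close> the covariance
  \<open>[u,v] = \<Sum>r\<^sub>i\<langle>u\<^sub>i,v\<^sub>i\<rangle> - \<langle>\<Sum>r\<^sub>iu\<^sub>i,\<Sum>r\<^sub>iv\<^sub>i\<rangle>\<close> is an \<open>A\<close>-valued semi-inner product on \<open>X\<^sup>n\<close>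
  that does not change when constant vectors are subtracted from \<open>u\<close> and \<open>v\<close>, and
  \<open>0 \<le> [u,u] \<le> \<Sum>\<langle>u\<^sub>i,u\<^sub>i\<rangle>\<close>. Subtracting the constant vectors with entries \<open>(x\<^sub>0+y\<^sub>0)a/2\<close> and
  \<open>(x\<^sub>1+y\<^sub>1)a/2\<close>, the Cauchy--Schwarz inequality for \<open>[\<cdot>,\<cdot>]\<close> gives the claim.
  The order properties of a C*-algebra that this needs are derived from two facts about
  self-adjoint elements: the spectrum is real, and the norm is the spectral radius.\<close>

text \<open>The obstacle is the Cauchy-Schwarz inequality: its usual proof compares
  \<open>star b * c * b\<close> with a multiple of \<open>star b * b\<close> in the order, which
  presupposes that elements \<open>star b * b\<close> are positive. Here such terms are estimated in
  norm only, and a weaker fact suffices: if \<open>a - star b * b\<close> is positive, then the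
  square of the norm of \<open>b\<close> is at most the norm of \<open>a\<close>. This can be
  reached without functional calculus. Spectra need a unit, so the order theory is developed for
  unital algebras and applied to the unitization, which must first be given a complete C*-norm.
  Cauchy-Schwarz is proved once, in the module locale, and reused for the covariance by showing that
  the covariance is itself a semi-inner product on the direct sum. The upper bound on the covariance
  comes from the weights being at most 1. Since the codomain has only a seminorm, derivatives of the
  components need not equal the components of the derivative; they agree up to seminorm 0.\<close>

lemma scaleC_one [simp]: "1 *\<^sub>C x = (x::'a::complex_vector)"
  using scaleR_scaleC[of 1 x] by simp

lemma scaleC_zero_left [simp]: "0 *\<^sub>C x = (0::'a::complex_vector)"
  using scaleR_scaleC[of 0 x] by simp

lemma scaleC_zero_right [simp]: "c *\<^sub>C 0 = (0::'a::complex_vector)"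
  using scaleC_add_right[of c "0::'a" 0] by simp

lemma scaleC_minus_right [simp]: "c *\<^sub>C (- x) = - (c *\<^sub>C (x::'a::complex_vector))"
  using scaleC_add_right[of c x "- x"] by (simp add: minus_unique)

lemma scaleC_minus_left [simp]: "(- c) *\<^sub>C x = - (c *\<^sub>C (x::'a::complex_vector))"
  using scaleC_add_left[of c "- c" x] by (simp add: minus_unique)

lemma scaleC_diff_right: "c *\<^sub>C (x - y) = c *\<^sub>C x - c *\<^sub>C (y::'a::complex_vector)"
  using scaleC_add_right[of c x "- y"] by simp

lemma scaleC_diff_left: "(c - d) *\<^sub>C x = c *\<^sub>C x - d *\<^sub>C (x::'a::complex_vector)"
  using scaleC_add_left[of c "- d" x] by simp

lemma star_zero [simp]: "star (0::'a::cstar_algebra) = 0"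
  using star_add[of "0::'a" 0] by simp

lemma star_minus: "star (- x) = - star (x::'a::cstar_algebra)"
  using star_add[of x "- x"] by (simp add: minus_unique)

lemma star_diff: "star (x - y) = star x - star (y::'a::cstar_algebra)"
  using star_add[of x "- y"] by (simp add: star_minus)

lemma star_scaleR: "star (r *\<^sub>R x) = r *\<^sub>R star (x::'a::cstar_algebra)"
  by (simp add: scaleR_scaleC star_scaleC)

lemma star_sum: "star (\<Sum>i\<in>I. f i) = (\<Sum>i\<in>I. star (f i :: 'a::cstar_algebra))"
  by (induction I rule: infinite_finite_induct) (auto simp: star_add)

lemma norm_star [simp]: "norm (star x) = norm (x::'a::cstar_algebra)"
proof -
  have le: "norm y \<le> norm (star y)" for y :: 'a
  proof (cases "y = 0")
    case False
    have "(norm y)\<^sup>2 \<le> norm (star y) * norm y"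
      by (metis cstar_identity norm_mult_ineq)
    then show ?thesis
      using False by (simp add: power2_eq_square)
  qed simp
  show ?thesis
    using le[of x] le[of "star x"] by (simp add: star_star)
qed

lemma star_one [simp]: "star (1::'a::{cstar_algebra,ring_1}) = 1"
  by (metis mult.left_neutral mult.right_neutral star_mult star_star)

subsection \<open>Spectrum and positivity in unital C*-algebras\<close>

definition is_inverse :: "'a::ring_1 \<Rightarrow> 'a \<Rightarrow> bool" where
  "is_inverse x y \<longleftrightarrow> x * y = 1 \<and> y * x = 1"

text \<open>A second notion of spectrum, using the unit of the algebra itself. At the type of the
  unitization it gives back \<open>spectrum\<close> (see \<open>cstar_positive_iff\<close>).\<close>

definition unital_spectrum :: "'a::{cstar_algebra,ring_1} \<Rightarrow> complex set" where
  "unital_spectrum x = {l. \<not> (\<exists>y. is_inverse (x - l *\<^sub>C 1) y)}"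

definition positive :: "'a::{cstar_algebra,ring_1} \<Rightarrow> bool" where
  "positive x \<longleftrightarrow> star x = x \<and> unital_spectrum x \<subseteq> complex_of_real ` {0..}"

lemma is_inverse_mult:
  "is_inverse x x' \<Longrightarrow> is_inverse y y' \<Longrightarrow> is_inverse (x * y) (y' * x')"
  unfolding is_inverse_def by (metis mult.assoc mult.left_neutral)

lemma is_inverse_scaleC:
  fixes x y :: "'a::{cstar_algebra,ring_1}"
  assumes "is_inverse x y" "c \<noteq> 0"
  shows "is_inverse (c *\<^sub>C x) (inverse c *\<^sub>C y)"
  using assms by (simp add: is_inverse_def mult_scaleC_left mult_scaleC_right scaleC_scaleC)

lemma scaleC_mem_spectrum_iff:
  fixes x :: "'a::{cstar_algebra,ring_1}"
  assumes "c \<noteq> 0"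
  shows "c * l \<in> unital_spectrum (c *\<^sub>C x) \<longleftrightarrow> l \<in> unital_spectrum x"
proof -
  have "(\<exists>y. is_inverse (c *\<^sub>C x - (c * l) *\<^sub>C 1) y) \<longleftrightarrow> (\<exists>y. is_inverse (x - l *\<^sub>C 1) y)"
    (is "?L \<longleftrightarrow> ?R")
  proof
    assume ?R
    then obtain y where "is_inverse (x - l *\<^sub>C 1) y" by blast
    from is_inverse_scaleC[OF this assms] show ?L
      by (auto simp: scaleC_diff_right scaleC_scaleC)
  next
    assume ?L
    then obtain y where y: "is_inverse (c *\<^sub>C x - (c * l) *\<^sub>C 1) y" by blast
    have "inverse c *\<^sub>C (c *\<^sub>C x - (c * l) *\<^sub>C 1) = x - l *\<^sub>C (1::'a)"
      using assms by (simp add: scaleC_diff_right scaleC_scaleC flip: mult.assoc)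
    then show ?R
      using is_inverse_scaleC[OF y, of "inverse c"] assms by auto
  qed
  then show ?thesis by (auto simp: unital_spectrum_def)
qed

lemma diff_mem_spectrum_iff:
  "l \<in> unital_spectrum (c *\<^sub>C 1 - x) \<longleftrightarrow> c - l \<in> unital_spectrum (x::'a::{cstar_algebra,ring_1})"
proof -
  have "- 1 * (c - l) \<in> unital_spectrum ((- 1) *\<^sub>C x) \<longleftrightarrow> c - l \<in> unital_spectrum x"
    by (rule scaleC_mem_spectrum_iff) simp
  then show ?thesis
    by (simp add: unital_spectrum_def scaleC_diff_left algebra_simps)
qed

lemma add_mem_spectrum_iff:
  "l \<in> unital_spectrum (c *\<^sub>C 1 + x) \<longleftrightarrow> l - c \<in> unital_spectrum (x::'a::{cstar_algebra,ring_1})"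
  by (simp add: unital_spectrum_def scaleC_diff_left algebra_simps)

section \<open>Neumann series and first bounds on the spectrum\<close>

lemma is_inverse_Neumann:
  fixes x :: "'a::{real_normed_algebra_1,banach}"
  assumes "norm x < 1"
  shows "is_inverse (1 - x) (\<Sum>n. x ^ n)"
proof -
  have s: "summable (\<lambda>n. x ^ n)"
    using assms by (rule complete_algebra_summable_geometric)
  have "(\<Sum>n. x ^ n) = 1 + (\<Sum>n. x ^ Suc n)"
    using suminf_split_head[OF s] by (simp add: algebra_simps)
  moreover have "(\<Sum>n. x ^ Suc n) = x * (\<Sum>n. x ^ n)"
    using suminf_mult[OF s] by simp
  moreover have "(\<Sum>n. x ^ Suc n) = (\<Sum>n. x ^ n) * x"
    using suminf_mult2[OF s, of x] by (simp add: power_commutes)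
  ultimately show ?thesis
    by (simp add: is_inverse_def algebra_simps)
qed

text \<open>For \<open>l\<close> larger than the norm, \<open>x - l *\<^sub>C 1\<close> is
  \<open>-l\<close> times \<open>1 - z\<close> with \<open>z\<close> of norm below 1, hence
  invertible by the Neumann series.\<close>

lemma norm_spectrum_le:
  fixes x :: "'a::{cstar_algebra,real_normed_algebra_1}"
  assumes "l \<in> unital_spectrum x"
  shows "cmod l \<le> norm x"
proof (rule ccontr)
  assume less: "\<not> cmod l \<le> norm x"
  then have l: "l \<noteq> 0" by auto
  define z where "z = inverse l *\<^sub>C x"
  have "norm z = norm x / cmod l"
    by (simp add: z_def norm_scaleC norm_inverse divide_inverse mult.commute)
  then have "norm z < 1"
    using less l by (simp add: divide_less_eq)
  from is_inverse_scaleC[OF is_inverse_Neumann[OF this], of "- l"] l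
  show False
    using assms by (auto simp: z_def unital_spectrum_def scaleC_diff_right scaleC_scaleC)
qed

text \<open>Arens' trick: translate by an imaginary multiple \<open>t\<close> of the unit. The
  squared norm grows only by the square of \<open>t\<close>, whereas the squared modulus of the
  translated \<open>l\<close> also gains \<open>2 * Im l * t\<close>. This is linear in
  \<open>t\<close> and cannot stay bounded unless \<open>Im l\<close> vanishes.\<close>

lemma selfadjoint_spectrum_real:
  fixes h :: "'a::{cstar_algebra,real_normed_algebra_1}"
  assumes h: "star h = h" and l: "l \<in> unital_spectrum h"
  shows "Im l = 0"
proof -
  have bound: "2 * Im l * t \<le> (norm h)\<^sup>2" for t :: real
  proof -
    define k where "k = (\<i> * t) *\<^sub>C 1 + h"
    have "l + \<i> * t \<in> unital_spectrum k"
      using l by (simp add: k_def add_mem_spectrum_iff)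
    then have "(cmod (l + \<i> * t))\<^sup>2 \<le> (norm k)\<^sup>2"
      by (intro power_mono norm_spectrum_le) auto
    also have "\<dots> = norm (star k * k)"
      by (simp add: cstar_identity)
    also have "star k * k = (t\<^sup>2) *\<^sub>R 1 + h * h"
      using h by (simp add: k_def star_add star_scaleC algebra_simps mult_scaleC_left
          mult_scaleC_right scaleC_scaleC scaleC_diff_right scaleR_scaleC power2_eq_square)
    also have "norm \<dots> \<le> t\<^sup>2 + (norm h)\<^sup>2"
      by (rule norm_triangle_le) (use norm_mult_ineq[of h h] in \<open>simp add: power2_eq_square\<close>)
    finally have "(Re l)\<^sup>2 + (Im l + t)\<^sup>2 \<le> t\<^sup>2 + (norm h)\<^sup>2"
      by (simp add: cmod_power2)
    moreover have "0 \<le> (Re l)\<^sup>2" "0 \<le> (Im l)\<^sup>2" by auto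
    ultimately show ?thesis unfolding power2_sum by linarith
  qed
  show ?thesis
  proof (rule ccontr)
    assume "Im l \<noteq> 0"
    then show False
      using bound[of "((norm h)\<^sup>2 + 1) / (2 * Im l)"] by simp
  qed
qed

text \<open>Rickart's elementary route to the spectral radius. Averaging over the two square roots \<open>v\<close> and
  \<open>-v\<close> of \<open>w\<close>, \<open>2(1 - wx\<^sup>2)\<^sup>-\<^sup>1 = (1 - vx)\<^sup>-\<^sup>1 + (1 + vx)\<^sup>-\<^sup>1\<close>, transports the estimate from \<open>x\<close> to
  \<open>x\<^sup>2\<close>. If \<open>\<parallel>x\<parallel> = 1\<close> and the spectrum lies in the open unit disc, uniform continuity of the
  resolvent thus forces \<open>x^(2^k)\<close> to become small, contradicting \<open>\<parallel>x^(2^k)\<parallel> = 1\<close>.\<close>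

definition resolvent_close :: "'a::{cstar_algebra,real_normed_algebra_1} \<Rightarrow> real \<Rightarrow> real \<Rightarrow> bool" where
  "resolvent_close x e s \<longleftrightarrow> (\<forall>w. cmod w \<le> 1 \<longrightarrow>
     (\<exists>A B. is_inverse (1 - w *\<^sub>C x) A \<and> is_inverse (1 - (complex_of_real s * w) *\<^sub>C x) B \<and>
        norm (A - B) \<le> e))"

lemma is_inverse_square:
  fixes x :: "'a::{cstar_algebra,real_normed_algebra_1}"
  assumes A: "is_inverse (1 - w *\<^sub>C x) A" and B: "is_inverse (1 - (- w) *\<^sub>C x) B"
  shows "is_inverse (1 - (w * w) *\<^sub>C (x * x)) ((1/2) *\<^sub>R (A + B))"
proof -
  define y where "y = w *\<^sub>C x"
  have yy: "(w * w) *\<^sub>C (x * x) = y * y"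
    by (simp add: y_def mult_scaleC_left mult_scaleC_right scaleC_scaleC)
  have A: "(1 - y) * A = 1" "A * (1 - y) = 1" and B: "(1 + y) * B = 1" "B * (1 + y) = 1"
    using assms by (simp_all add: is_inverse_def y_def)
  have 1: "1 - y * y = (1 + y) * (1 - y)" and 2: "1 - y * y = (1 - y) * (1 + y)"
    by (simp_all add: algebra_simps)
  have "(1 - y * y) * (A + B) = (1 + y) * ((1 - y) * A) + (1 - y) * ((1 + y) * B)"
    using 1 2 by (metis distrib_left mult.assoc)
  also have "\<dots> = 2 *\<^sub>R 1" by (simp add: A B scaleR_2)
  finally have l: "(1 - y * y) * (A + B) = 2 *\<^sub>R 1" .
  have "(A + B) * (1 - y * y) = (A * (1 - y)) * (1 + y) + (B * (1 + y)) * (1 - y)"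
    using 1 2 by (metis distrib_right mult.assoc)
  also have "\<dots> = 2 *\<^sub>R 1" by (simp add: A B scaleR_2)
  finally have r: "(A + B) * (1 - y * y) = 2 *\<^sub>R 1" .
  show ?thesis
    by (simp add: is_inverse_def yy l r)
qed

text \<open>The error does not grow, since averaging two pairs at distance at most \<open>e\<close>
  keeps that distance, while the radius shrinks because \<open>s * v\<close> and
  \<open>s * - v\<close> are the square roots of \<open>s\<^sup>2 * w\<close>.\<close>

lemma resolvent_close_square:
  assumes "resolvent_close x e s"
  shows "resolvent_close (x * x) e (s\<^sup>2)"
  unfolding resolvent_close_def
proof (intro allI impI)
  fix w assume w: "cmod w \<le> 1"
  define v where "v = csqrt w"
  have vv: "v * v = w" by (simp add: v_def flip: power2_eq_square)
  have v: "cmod v \<le> 1" "cmod (- v) \<le> 1" using w by (simp_all add: v_def)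
  from assms v(1) obtain A B where AB: "is_inverse (1 - v *\<^sub>C x) A"
    "is_inverse (1 - (s * v) *\<^sub>C x) B" "norm (A - B) \<le> e"
    unfolding resolvent_close_def by blast
  from assms v(2) obtain A' B' where AB': "is_inverse (1 - (- v) *\<^sub>C x) A'"
    "is_inverse (1 - (s * - v) *\<^sub>C x) B'" "norm (A' - B') \<le> e"
    unfolding resolvent_close_def by blast
  have "is_inverse (1 - w *\<^sub>C (x * x)) ((1/2) *\<^sub>R (A + A'))"
    using is_inverse_square[OF AB(1) AB'(1)] by (simp add: vv)
  moreover have "(s * v) * (s * v) = (s\<^sup>2) * w"
    by (simp add: power2_eq_square flip: vv)
  with is_inverse_square[OF AB(2), of B'] AB'(2)
  have "is_inverse (1 - (complex_of_real (s\<^sup>2) * w) *\<^sub>C (x * x)) ((1/2) *\<^sub>R (B + B'))"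
    by simp
  moreover have "norm ((1/2) *\<^sub>R (A + A') - (1/2) *\<^sub>R (B + B')) \<le> e"
  proof -
    have "(1/2) *\<^sub>R (A + A') - (1/2) *\<^sub>R (B + B') = (1/2) *\<^sub>R ((A - B) + (A' - B'))"
      by (simp add: algebra_simps)
    also have "norm \<dots> \<le> (1/2) * (norm (A - B) + norm (A' - B'))"
      by (simp add: norm_triangle_ineq)
    finally show ?thesis using AB(3) AB'(3) by simp
  qed
  ultimately show "\<exists>A B. is_inverse (1 - w *\<^sub>C (x * x)) A \<and>
      is_inverse (1 - (complex_of_real (s\<^sup>2) * w) *\<^sub>C (x * x)) B \<and> norm (A - B) \<le> e"
    by blast
qed

text \<open>The resolvent identity \<open>id\<close> makes \<open>G v - G w\<close> small once
  \<open>G v\<close> is bounded near \<open>w\<close>; the identity itself gives that bound, twice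
  the norm of \<open>G w\<close>.\<close>

lemma resolvent_continuous:
  fixes x :: "'a::{cstar_algebra,real_normed_algebra_1}"
  assumes G: "\<And>w. w \<in> S \<Longrightarrow> is_inverse (1 - w *\<^sub>C x) (G w)"
  shows "continuous_on S G"
proof -
  have id: "G v - G w = (v - w) *\<^sub>C (G w * x * G v)" if "v \<in> S" "w \<in> S" for v w
  proof -
    have "G v = G w * (1 - w *\<^sub>C x) * G v" "G w = G w * ((1 - v *\<^sub>C x) * G v)"
      using G[OF that(1)] G[OF that(2)] by (simp_all add: is_inverse_def)
    then have "G v - G w = G w * ((1 - w *\<^sub>C x) - (1 - v *\<^sub>C x)) * G v"
      by (simp add: algebra_simps)
    also have "(1 - w *\<^sub>C x) - (1 - v *\<^sub>C x) = (v - w) *\<^sub>C x"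
      by (simp add: scaleC_diff_left)
    finally show ?thesis by (simp add: mult_scaleC_left mult_scaleC_right)
  qed
  have "(G \<longlongrightarrow> G w) (at w within S)" if w: "w \<in> S" for w
  proof -
    define C where "C = norm (G w) * norm x"
    have C: "C \<ge> 0" by (simp add: C_def)
    have est: "norm (G v - G w) \<le> 2 * (cmod (v - w) * C) * norm (G w)"
      if v: "v \<in> S" "cmod (v - w) * C \<le> 1/2" for v
    proof -
      have "norm (G v - G w) \<le> cmod (v - w) * (norm (G w * x) * norm (G v))"
        unfolding id[OF v(1) w] norm_scaleC
        by (intro mult_left_mono norm_mult_ineq) auto
      also have "\<dots> \<le> cmod (v - w) * (C * norm (G v))"
        unfolding C_def by (intro mult_left_mono mult_right_mono norm_mult_ineq) auto
      finally have 1: "norm (G v - G w) \<le> (cmod (v - w) * C) * norm (G v)"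
        by (simp add: mult.assoc)
      also have "\<dots> \<le> (1/2) * norm (G v)"
        using v(2) by (rule mult_right_mono) simp
      finally have "norm (G v) \<le> 2 * norm (G w)"
        using norm_triangle_ineq2[of "G v" "G w"] by simp
      then have "(cmod (v - w) * C) * norm (G v) \<le> (cmod (v - w) * C) * (2 * norm (G w))"
        using C by (intro mult_left_mono) auto
      with 1 show ?thesis by simp
    qed
    have lim: "((\<lambda>v. cmod (v - w) * C) \<longlongrightarrow> 0) (at w within S)"
      by (auto intro!: tendsto_eq_intros)
    then have "\<forall>\<^sub>F v in at w within S. cmod (v - w) * C < 1/2"
      by (rule order_tendstoD) simp
    moreover have "\<forall>\<^sub>F v in at w within S. v \<in> S"
      by (simp add: eventually_at_filter)
    ultimately have "\<forall>\<^sub>F v in at w within S.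
        norm (G v - G w) \<le> 2 * (cmod (v - w) * C) * norm (G w)"
      by eventually_elim (rule est, auto)
    moreover have "((\<lambda>v. 2 * (cmod (v - w) * C) * norm (G w)) \<longlongrightarrow> 0) (at w within S)"
      using tendsto_mult[OF tendsto_mult[OF tendsto_const lim, of 2] tendsto_const] by simp
    ultimately have "((\<lambda>v. G v - G w) \<longlongrightarrow> 0) (at w within S)"
      by (rule Lim_null_comparison)
    then show ?thesis by (rule LIM_zero_cancel)
  qed
  then show ?thesis by (simp add: continuous_on_def)
qed

text \<open>On self-adjoint elements the C*-identity says that squaring squares the norm. Only
  exponents that are powers of two are reached this way, which is why the resolvent argument squares
  repeatedly.\<close>

lemma selfadjoint_power_two_power:
  fixes x :: "'a::{cstar_algebra,real_normed_algebra_1}"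
  assumes x: "star x = x"
  shows "star (x ^ 2 ^ k) = x ^ 2 ^ k \<and> norm (x ^ 2 ^ k) = norm x ^ 2 ^ k"
proof (induction k)
  case (Suc k)
  have "x ^ 2 ^ Suc k = x ^ 2 ^ k * x ^ 2 ^ k"
    by (simp add: mult_2 power_add)
  with Suc cstar_identity[of "x ^ 2 ^ k"] show ?case
    by (simp add: star_mult power2_eq_square power_add mult_2)
qed (use x in auto)

lemma norm_selfadjoint_le_spectral_bound:
  fixes x :: "'a::{cstar_algebra,real_normed_algebra_1}"
  assumes x: "star x = x" and R: "R \<ge> 0" and bound: "\<And>l. l \<in> unital_spectrum x \<Longrightarrow> cmod l \<le> R"
  shows "norm x \<le> R"
proof (rule ccontr)
  assume "\<not> norm x \<le> R"
  define N where "N = norm x"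
  have N: "N > R" "N > 0"
    using \<open>\<not> norm x \<le> R\<close> R by (auto simp: N_def)
  define y where "y = inverse N *\<^sub>R x"
  have y: "star y = y" "norm y = 1"
    using x N by (simp_all add: y_def star_scaleR N_def)
  \<comment> \<open>For nonzero \<open>w\<close> this is \<open>-w/N\<close> times
    \<open>x - (N/w) *\<^sub>C 1\<close>, and \<open>N/w\<close> has modulus at least
    \<open>N > R\<close>, so it is outside the spectrum.\<close>
  have "\<exists>z. is_inverse (1 - w *\<^sub>C y) z" if w: "cmod w \<le> 1" for w
  proof (cases "w = 0")
    case True
    then have "is_inverse (1 - w *\<^sub>C y) 1" by (simp add: is_inverse_def)
    then show ?thesis by blast
  next
    case False
    have "cmod w * N \<le> 1 * N"
      using w N by (intro mult_right_mono) auto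
    then have "cmod (N / w) \<ge> N"
      using False N by (simp add: norm_divide field_simps)
    then have "N / w \<notin> unital_spectrum x"
      using bound N by force
    then obtain z where z: "is_inverse (x - (N / w) *\<^sub>C 1) z"
      by (auto simp: unital_spectrum_def)
    have "(- w / N) *\<^sub>C (x - (N / w) *\<^sub>C 1) = 1 - w *\<^sub>C y"
      using False N by (simp add: scaleC_diff_right scaleC_scaleC y_def scaleR_scaleC field_simps)
    then show ?thesis
      using is_inverse_scaleC[OF z, of "- w / N"] False N by auto
  qed
  then obtain G where G: "\<And>w. w \<in> cball 0 1 \<Longrightarrow> is_inverse (1 - w *\<^sub>C y) (G w)"
    by (metis mem_cball_0)
  have "uniformly_continuous_on (cball 0 1) G"
    by (intro compact_uniformly_continuous resolvent_continuous[OF G]) auto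
  then obtain d where d: "d > 0" "\<And>v w. v \<in> cball 0 1 \<Longrightarrow> w \<in> cball 0 1 \<Longrightarrow> dist w v < d \<Longrightarrow>
      dist (G w) (G v) < 1/4"
    unfolding uniformly_continuous_on_def by (meson zero_less_divide_1_iff zero_less_numeral)
  \<comment> \<open>Close enough to 1 for uniform continuity to apply, but strictly below 1 so that
    its powers vanish; the maximum keeps it nonnegative when \<open>d\<close> is large.\<close>
  define s where "s = max (1 - d / 2) 0"
  have s: "0 \<le> s" "s < 1" "1 - s < d" using d(1) by (auto simp: s_def)
  have "resolvent_close y (1/4) s"
    unfolding resolvent_close_def
  proof (intro allI impI)
    fix w assume w: "cmod w \<le> 1"
    have "cmod (s * w) \<le> 1 * 1"
      unfolding norm_mult using s w by (intro mult_mono) auto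
    then have sw: "complex_of_real s * w \<in> cball 0 1" by simp
    have "dist w (s * w) = cmod ((1 - s) * w)"
      by (simp add: dist_norm algebra_simps)
    also have "\<dots> = (1 - s) * cmod w"
      using s unfolding norm_mult by (metis abs_of_nonneg diff_ge_0_iff_ge less_imp_le norm_of_real of_real_1 of_real_diff)
    also have "\<dots> \<le> 1 - s" using s w by (simp add: mult_left_le)
    finally have "dist (G w) (G (s * w)) < 1/4"
      using sw w s by (intro d(2)) auto
    then show "\<exists>A B. is_inverse (1 - w *\<^sub>C y) A \<and> is_inverse (1 - (complex_of_real s * w) *\<^sub>C y) B
        \<and> norm (A - B) \<le> 1/4"
      using G[of w] G[OF sw] w by (auto simp: dist_norm intro!: exI)
  qed
  then have close: "resolvent_close (y ^ 2 ^ k) (1/4) (s ^ 2 ^ k)" for k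
  proof (induction k)
    case (Suc k)
    from resolvent_close_square[OF Suc.IH[OF Suc.prems]] show ?case
      by (simp add: mult_2 power_add power2_eq_square)
  qed simp
  \<comment> \<open>It is enough to make \<open>s ^ k\<close> small, because the exponent
    \<open>2 ^ k\<close> is at least \<open>k\<close>.\<close>
  have "(\<lambda>n. s ^ n) \<longlonglongrightarrow> 0"
    using s by (intro LIMSEQ_realpow_zero) auto
  then obtain k where k: "s ^ k < 1/10"
    by (metis (no_types, lifting) dual_order.refl eventually_sequentially order_tendstoD(2) zero_less_divide_1_iff zero_less_numeral)
  define \<sigma> where "\<sigma> = s ^ 2 ^ k"
  have "\<sigma> \<le> s ^ k"
    unfolding \<sigma>_def using s by (intro power_decreasing) auto
  with k s have \<sigma>: "0 \<le> \<sigma>" "\<sigma> \<le> 1/10" by (auto simp: \<sigma>_def)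
  define z where "z = y ^ 2 ^ k"
  have z: "norm z = 1"
    using selfadjoint_power_two_power[OF y(1), of k] y(2) by (simp add: z_def)
  from close[of k] obtain A B where A: "is_inverse (1 - 1 *\<^sub>C z) A"
    and B: "is_inverse (1 - (complex_of_real \<sigma> * 1) *\<^sub>C z) B" and AB: "norm (A - B) \<le> 1/4"
    unfolding resolvent_close_def z_def \<sigma>_def by (metis norm_one order_refl)
  \<comment> \<open>For small \<open>\<sigma>\<close> the inverse \<open>B\<close> is near 1, and
    \<open>A\<close> is near \<open>B\<close>. So \<open>z = (A - 1) * (1 - z)\<close> has norm at
    most 2 * (1/4 + 1/9) = 13/18, contradicting norm 1. The constants 1/4 and 1/10 only have to
    bring this value below 1.\<close>
  have "B - 1 = \<sigma> *\<^sub>R (z * B)"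
    using B by (simp add: is_inverse_def algebra_simps scaleR_scaleC mult_scaleC_left)
  then have "norm (B - 1) \<le> \<sigma> * norm B"
    using norm_mult_ineq[of z B] \<sigma> z by (simp add: mult_left_mono)
  also have "\<dots> \<le> (1/10) * (norm (B - 1) + 1)"
    using \<sigma> norm_triangle_ineq[of "B - 1" 1] by (intro mult_mono) auto
  finally have "norm (B - 1) \<le> 1/9" by simp
  then have A1: "norm (A - 1) \<le> 1/4 + 1/9"
    using AB norm_triangle_ineq[of "A - B" "B - 1"] by simp
  have "z = (A - 1) * (1 - z)"
    using A by (simp add: is_inverse_def algebra_simps)
  then have "norm z \<le> norm (A - 1) * norm (1 - z)"
    by (metis norm_mult_ineq)
  also have "\<dots> \<le> (1/4 + 1/9) * 2"
    using A1 norm_triangle_ineq4[of 1 z] z by (intro mult_mono) auto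
  finally show False using z by simp
qed

section \<open>Positivity as a norm inequality\<close>

lemma norm_diff_le_of_positive:
  fixes h :: "'a::{cstar_algebra,real_normed_algebra_1}"
  assumes h: "positive h" and t: "norm h \<le> t"
  shows "norm (t *\<^sub>R 1 - h) \<le> t"
proof (rule norm_selfadjoint_le_spectral_bound)
  show "star (t *\<^sub>R 1 - h) = t *\<^sub>R 1 - h"
    using h by (simp add: positive_def star_diff star_scaleR)
  show t0: "0 \<le> t" using t norm_ge_zero[of h] by linarith
  fix l assume "l \<in> unital_spectrum (t *\<^sub>R 1 - h)"
  then have m: "t - l \<in> unital_spectrum h"
    by (simp add: scaleR_scaleC diff_mem_spectrum_iff)
  then obtain u where u: "t - l = complex_of_real u" "u \<ge> 0"
    using h by (auto simp: positive_def)
  have "u \<le> t"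
    using norm_spectrum_le[OF m] u t by simp
  moreover have "l = complex_of_real (t - u)"
    using u(1) by (simp add: algebra_simps)
  ultimately show "cmod l \<le> t"
    using u(2) by (simp only: norm_of_real)
qed

text \<open>Converse of \<open>norm_diff_le_of_positive\<close>: the spectrum is real and lies
  within distance \<open>t\<close> of \<open>t\<close>. Positivity thus becomes a norm inequality,
  which is compatible with sums, whereas the spectra of non-commuting summands say little about the
  spectrum of their sum.\<close>

lemma positive_if_norm_diff_le:
  fixes h :: "'a::{cstar_algebra,real_normed_algebra_1}"
  assumes h: "star h = h" and t: "norm (t *\<^sub>R 1 - h) \<le> t"
  shows "positive h"
  unfolding positive_def
proof (intro conjI subsetI h)
  fix l assume l: "l \<in> unital_spectrum h"
  then have "t - l \<in> unital_spectrum (t *\<^sub>R 1 - h)"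
    by (simp add: scaleR_scaleC diff_mem_spectrum_iff)
  then have "cmod (t - l) \<le> t"
    using norm_spectrum_le t by fastforce
  moreover have l_eq: "l = complex_of_real (Re l)"
    using selfadjoint_spectrum_real[OF h l] by (simp add: complex_eq_iff)
  then have "t - l = complex_of_real (t - Re l)" by simp
  ultimately have "\<bar>t - Re l\<bar> \<le> t" by (metis norm_of_real)
  then have "Re l \<ge> 0" by linarith
  then show "l \<in> complex_of_real ` {0..}" using l_eq by blast
qed

lemma positive_add:
  fixes h k :: "'a::{cstar_algebra,real_normed_algebra_1}"
  assumes "positive h" "positive k"
  shows "positive (h + k)"
proof (rule positive_if_norm_diff_le)
  show "star (h + k) = h + k" using assms by (simp add: positive_def star_add)
  have "(norm h + norm k) *\<^sub>R 1 - (h + k) = (norm h *\<^sub>R 1 - h) + (norm k *\<^sub>R 1 - k)"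
    by (simp add: algebra_simps)
  also have "norm \<dots> \<le> norm h + norm k"
    using assms by (intro norm_triangle_mono norm_diff_le_of_positive) auto
  finally show "norm ((norm h + norm k) *\<^sub>R 1 - (h + k)) \<le> norm h + norm k" .
qed

lemma positive_scaleR:
  fixes h :: "'a::{cstar_algebra,real_normed_algebra_1}"
  assumes "positive h" "r \<ge> 0"
  shows "positive (r *\<^sub>R h)"
proof (rule positive_if_norm_diff_le)
  show "star (r *\<^sub>R h) = r *\<^sub>R h" using assms by (simp add: positive_def star_scaleR)
  have "(r * norm h) *\<^sub>R 1 - r *\<^sub>R h = r *\<^sub>R (norm h *\<^sub>R 1 - h)"
    by (simp add: algebra_simps)
  also have "norm \<dots> \<le> r * norm h"
    using assms norm_diff_le_of_positive[OF assms(1) order_refl] by (simp add: mult_left_mono)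
  finally show "norm ((r * norm h) *\<^sub>R 1 - r *\<^sub>R h) \<le> r * norm h" .
qed

text \<open>If \<open>l\<close> is the square of \<open>m\<close>, then
  \<open>h * h - l *\<^sub>C 1\<close> factors into the differences of \<open>h\<close> with
  \<open>m\<close> and \<open>-m\<close>. One factor must fail to be invertible, so \<open>m\<close>
  is real.\<close>

lemma positive_square:
  fixes h :: "'a::{cstar_algebra,real_normed_algebra_1}"
  assumes h: "star h = h"
  shows "positive (h * h)"
  unfolding positive_def
proof (intro conjI subsetI)
  show "star (h * h) = h * h" using h by (simp add: star_mult)
  fix l assume l: "l \<in> unital_spectrum (h * h)"
  define m where "m = csqrt l"
  have mm: "l = m * m" by (simp add: m_def flip: power2_eq_square)
  have "h * h - l *\<^sub>C 1 = (h - m *\<^sub>C 1) * (h - (- m) *\<^sub>C 1)"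
    by (simp add: mm algebra_simps mult_scaleC_left mult_scaleC_right scaleC_scaleC
        scaleC_diff_right)
  then have "m \<in> unital_spectrum h \<or> - m \<in> unital_spectrum h"
    using l is_inverse_mult unfolding unital_spectrum_def by fastforce
  then have "Im m = 0"
    using selfadjoint_spectrum_real[OF h] by fastforce
  then have "l = complex_of_real ((Re m)\<^sup>2)"
    by (simp add: mm complex_eq_iff power2_eq_square)
  then show "l \<in> complex_of_real ` {0..}" by (simp del: of_real_power)
qed

text \<open>With \<open>t = norm h\<close>, the element whose norm has to be at most
  \<open>t\<close> is \<open>h\<close> itself.\<close>

lemma positive_norm_diff:
  fixes h :: "'a::{cstar_algebra,real_normed_algebra_1}"
  assumes h: "star h = h"
  shows "positive (norm h *\<^sub>R 1 - h)"
  by (rule positive_if_norm_diff_le[where t = "norm h"])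
     (use h in \<open>simp_all add: star_diff star_scaleR\<close>)

text \<open>The spectrum is real and both hypotheses confine it to the interval from
  \<open>-s\<close> to \<open>s\<close>; the spectral radius bound does the rest.\<close>

lemma norm_le_if_positive_diffs:
  fixes h :: "'a::{cstar_algebra,real_normed_algebra_1}"
  assumes 1: "positive (s *\<^sub>R 1 - h)" and 2: "positive (s *\<^sub>R 1 + h)" and s: "s \<ge> 0"
  shows "norm h \<le> s"
proof (rule norm_selfadjoint_le_spectral_bound[OF _ s])
  show h: "star h = h" using 1 by (simp add: positive_def star_diff star_scaleR)
  fix l assume l: "l \<in> unital_spectrum h"
  have l_eq: "l = complex_of_real (Re l)"
    using selfadjoint_spectrum_real[OF h l] by (simp add: complex_eq_iff)
  have "s - l \<in> unital_spectrum (s *\<^sub>R 1 - h)" "s + l \<in> unital_spectrum (s *\<^sub>R 1 + h)"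
    using l by (simp_all add: scaleR_scaleC diff_mem_spectrum_iff add_mem_spectrum_iff)
  then have "s - l \<in> complex_of_real ` {0..}" "s + l \<in> complex_of_real ` {0..}"
    using 1 2 by (auto simp: positive_def)
  moreover have "Re z \<ge> 0" if "z \<in> complex_of_real ` {0..}" for z
    using that by auto
  ultimately have "Re (s - l) \<ge> 0" "Re (s + l) \<ge> 0" by blast+
  then have "\<bar>Re l\<bar> \<le> s" by auto
  then show "cmod l \<le> s" by (metis l_eq norm_of_real)
qed

lemma norm_mono_positive:
  fixes h k :: "'a::{cstar_algebra,real_normed_algebra_1}"
  assumes h: "positive h" and hk: "positive (k - h)"
  shows "norm h \<le> norm k"
proof (rule norm_le_if_positive_diffs)
  have k: "star k = k"
    using positive_add[OF h hk] by (simp add: positive_def)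
  \<comment> \<open>This is the sum of \<open>norm k *\<^sub>R 1 - k\<close> and
    \<open>k - h\<close>.\<close>
  show "positive (norm k *\<^sub>R 1 - h)"
    using positive_add[OF positive_norm_diff[OF k] hk] by simp
  have "positive (norm k *\<^sub>R (1::'a))"
    using positive_square[of "1::'a"] by (intro positive_scaleR) auto
  then show "positive (norm k *\<^sub>R 1 + h)"
    using h by (rule positive_add)
qed simp

text \<open>Jacobson's lemma: if \<open>z\<close> inverts \<open>y * x - l *\<^sub>C 1\<close>, then
  \<open>inverse l *\<^sub>C (x * z * y - 1)\<close> inverts \<open>x * y - l *\<^sub>C 1\<close>.
  The formula is suggested by expanding both inverses as geometric series in
  \<open>1/l\<close>.\<close>

lemma spectrum_mult_swap:
  fixes x y :: "'a::{cstar_algebra,ring_1}"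
  assumes l: "l \<in> unital_spectrum (x * y)" "l \<noteq> 0"
  shows "l \<in> unital_spectrum (y * x)"
proof (rule ccontr)
  assume "l \<notin> unital_spectrum (y * x)"
  then obtain z where "is_inverse (y * x - l *\<^sub>C 1) z"
    by (auto simp: unital_spectrum_def)
  then have z: "y * x * z = 1 + l *\<^sub>C z" "z * (y * x) = 1 + l *\<^sub>C z"
    by (simp_all add: is_inverse_def algebra_simps mult_scaleC_left mult_scaleC_right)
  have "is_inverse (x * y - l *\<^sub>C 1) (inverse l *\<^sub>C (x * z * y - 1))"
  proof -
    have "(x * y - l *\<^sub>C 1) * (x * z * y - 1) = x * (y * x * z) * y - x * y - l *\<^sub>C (x * z * y) + l *\<^sub>C 1"
      by (simp add: algebra_simps mult_scaleC_left mult_scaleC_right scaleC_diff_right)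
    also have "\<dots> = l *\<^sub>C 1"
      unfolding z by (simp add: algebra_simps mult_scaleC_left mult_scaleC_right)
    finally have a: "(x * y - l *\<^sub>C 1) * (x * z * y - 1) = l *\<^sub>C 1" .
    have "(x * z * y - 1) * (x * y - l *\<^sub>C 1) = x * (z * (y * x)) * y - x * y - l *\<^sub>C (x * z * y) + l *\<^sub>C 1"
      by (simp add: algebra_simps mult_scaleC_left mult_scaleC_right scaleC_diff_right)
    also have "\<dots> = l *\<^sub>C 1"
      unfolding z by (simp add: algebra_simps mult_scaleC_left mult_scaleC_right)
    finally have b: "(x * z * y - 1) * (x * y - l *\<^sub>C 1) = l *\<^sub>C 1" .
    show ?thesis
      using a b l(2) by (simp add: is_inverse_def mult_scaleC_left mult_scaleC_right scaleC_scaleC)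
  qed
  with l(1) show False by (auto simp: unital_spectrum_def)
qed

text \<open>An upper bound \<open>s\<close> of \<open>b\<^sup>*b\<close> also bounds \<open>bb\<^sup>*\<close>, because the nonzero spectra agree.
  Since \<open>b\<^sup>*b + bb\<^sup>*\<close> is a sum of squares, this gives \<open>b\<^sup>*b \<ge> -s\<close> without knowing that \<open>b\<^sup>*b\<close> is
  positive.\<close>

lemma norm_le_if_star_mult_le:
  fixes b f :: "'a::{cstar_algebra,real_normed_algebra_1}"
  assumes pos: "positive (f - star b * b)"
  shows "(norm b)\<^sup>2 \<le> norm f"
proof -
  define s where "s = norm f"
  have sa: "star (star b * b) = star b * b" "star (b * star b) = b * star b"
    by (simp_all add: star_mult star_star)
  have f: "star f = f"
    using pos sa by (simp add: positive_def star_diff)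
  have p1: "positive (s *\<^sub>R 1 - star b * b)"
    using positive_add[OF positive_norm_diff[OF f] pos] by (simp add: s_def)
  have p2: "positive (s *\<^sub>R 1 - b * star b)"
    unfolding positive_def
  proof (intro conjI subsetI)
    show "star (s *\<^sub>R 1 - b * star b) = s *\<^sub>R 1 - b * star b"
      by (simp add: star_diff sa star_scaleR)
    fix l assume "l \<in> unital_spectrum (s *\<^sub>R 1 - b * star b)"
    then have m: "s - l \<in> unital_spectrum (b * star b)"
      by (simp add: scaleR_scaleC diff_mem_spectrum_iff)
    \<comment> \<open>The swap covers only nonzero points of the spectrum. The remaining point has
      \<open>l = s\<close>, which is nonnegative anyway.\<close>
    show "l \<in> complex_of_real ` {0..}"
    proof (cases "s - l = 0")
      case True
      then have "l = complex_of_real s" by simp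
      then show ?thesis by (simp add: s_def)
    next
      case False
      with spectrum_mult_swap[OF m] have "l \<in> unital_spectrum (s *\<^sub>R 1 - star b * b)"
        by (simp add: scaleR_scaleC diff_mem_spectrum_iff)
      with p1 show ?thesis by (auto simp: positive_def)
    qed
  qed
  \<comment> \<open>Up to factors 2 and -2, \<open>h\<close> and \<open>k\<close> are the real and
    imaginary parts of \<open>b\<close>; in the sum of their squares the terms \<open>b * b\<close>
    and \<open>star b * star b\<close> cancel.\<close>
  define h where "h = b + star b"
  define k where "k = \<i> *\<^sub>C (b - star b)"
  have "star h = h" "star k = k"
    by (simp_all add: h_def k_def star_add star_diff star_scaleC star_star scaleC_diff_right)
  then have "positive ((1/2) *\<^sub>R (h * h + k * k))"
    by (intro positive_scaleR positive_add positive_square) auto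
  also have "h * h + k * k = 2 *\<^sub>R (star b * b + b * star b)"
    by (simp add: h_def k_def algebra_simps mult_scaleC_left mult_scaleC_right scaleC_scaleC scaleR_2
        scaleC_diff_right)
  finally have "positive (star b * b + b * star b)" by simp
  from positive_add[OF p2 this] have "positive (s *\<^sub>R 1 + star b * b)" by simp
  with p1 have "norm (star b * b) \<le> s"
    by (intro norm_le_if_positive_diffs) (auto simp: s_def)
  then show ?thesis by (simp add: cstar_identity s_def)
qed

subsection \<open>The unitization\<close>

text \<open>A type of its own, because pairs already carry the Euclidean product norm, which is not
  the norm wanted here.\<close>

datatype 'a unitization = Unitization (alg_part: 'a) (scalar_part: complex)

lemma unitization_eq_iff: "x = y \<longleftrightarrow> alg_part x = alg_part y \<and> scalar_part x = scalar_part y"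
  by (cases x; cases y) auto

instantiation unitization :: (cstar_algebra) "{complex_vector, real_algebra_1}"
begin

definition "0 = Unitization 0 0"
definition "1 = Unitization 0 1"
definition "x + y = Unitization (alg_part x + alg_part y) (scalar_part x + scalar_part y)"
definition "- x = Unitization (- alg_part x) (- scalar_part x)"
definition "x - y = Unitization (alg_part x - alg_part y) (scalar_part x - scalar_part y)"
definition "x * y = Unitization
  (alg_part x * alg_part y + scalar_part x *\<^sub>C alg_part y + scalar_part y *\<^sub>C alg_part x)
  (scalar_part x * scalar_part y)"
definition "r *\<^sub>R x = Unitization (r *\<^sub>R alg_part x) (r *\<^sub>R scalar_part x)"
definition "c *\<^sub>C x = Unitization (c *\<^sub>C alg_part x) (c * scalar_part x)"

lemmas unitization_defs = zero_unitization_def one_unitization_def plus_unitization_def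
  uminus_unitization_def minus_unitization_def times_unitization_def scaleR_unitization_def
  scaleC_unitization_def

instance
  by standard
    (simp_all add: unitization_defs unitization_eq_iff algebra_simps scaleC_add_right
      scaleC_add_left scaleC_scaleC scaleR_scaleC mult_scaleC_left mult_scaleC_right scaleR_conv_of_real)

end

section \<open>The C*-norm of the unitization\<close>

definition left_mult :: "'a::cstar_algebra unitization \<Rightarrow> 'a \<Rightarrow> 'a" where
  "left_mult x b = alg_part x * b + scalar_part x *\<^sub>C b"

lemma bounded_linear_left_mult: "bounded_linear (left_mult x)"
proof (rule bounded_linear_intro[where K = "norm (alg_part x) + cmod (scalar_part x)"])
  fix b
  have "norm (left_mult x b) \<le> norm (alg_part x) * norm b + cmod (scalar_part x) * norm b"
    unfolding left_mult_def
    by (intro norm_triangle_mono norm_mult_ineq) (simp add: norm_scaleC)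
  then show "norm (left_mult x b) \<le> norm b * (norm (alg_part x) + cmod (scalar_part x))"
    by (simp add: algebra_simps)
qed (auto simp: left_mult_def algebra_simps scaleC_add_right scaleR_scaleC scaleC_scaleC
    mult_scaleC_right)

lemma left_mult_mult: "left_mult (x * y) b = left_mult x (left_mult y b)"
  by (simp add: left_mult_def unitization_defs algebra_simps scaleC_add_right scaleC_scaleC
      mult_scaleC_left mult_scaleC_right)

lemma left_mult_add: "left_mult (x + y) b = left_mult x b + left_mult y b"
  by (simp add: left_mult_def unitization_defs algebra_simps scaleC_add_left)

lemma left_mult_scaleC: "left_mult (c *\<^sub>C x) b = c *\<^sub>C left_mult x b"
  by (simp add: left_mult_def unitization_defs algebra_simps scaleC_add_right scaleC_scaleC
      mult_scaleC_left)

lemma norm_left_mult: "norm (left_mult x b) \<le> onorm (left_mult x) * norm b"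
  by (rule onorm[OF bounded_linear_left_mult])

text \<open>The norm is attained, up to scaling, at \<open>star a\<close>, by the C*-identity. Hence
  the algebra embeds isometrically.\<close>

lemma onorm_left_mult_alg:
  fixes a :: "'a::cstar_algebra"
  shows "onorm (left_mult (Unitization a 0)) = norm a"
proof (rule antisym)
  show "onorm (left_mult (Unitization a 0)) \<le> norm a"
    by (rule onorm_bound) (auto simp: left_mult_def norm_mult_ineq)
  have "norm a * norm a = norm (left_mult (Unitization a 0) (star a))"
    using cstar_identity[of "star a"] by (simp add: left_mult_def star_star power2_eq_square)
  also have "\<dots> \<le> onorm (left_mult (Unitization a 0)) * norm a"
    using norm_left_mult[of "Unitization a 0" "star a"] by simp
  finally show "norm a \<le> onorm (left_mult (Unitization a 0))"
    using onorm_pos_le[OF bounded_linear_left_mult, of "Unitization a 0"]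
    by (cases "norm a = 0") (auto simp: mult_le_cancel_right)
qed

text \<open>The operator norm of left multiplication alone is only a seminorm when the algebra already
  has a unit; the maximum with the scalar part, the image under the character
  \<open>(a, \<alpha>) \<mapsto> \<alpha>\<close>, is a C*-norm in every case.\<close>

instantiation unitization :: (cstar_algebra) real_normed_algebra_1
begin

definition norm_unitization :: "'a unitization \<Rightarrow> real" where
  "norm x = max (onorm (left_mult x)) (cmod (scalar_part x))"
definition sgn_unitization :: "'a unitization \<Rightarrow> 'a unitization" where
  "sgn (x::'a unitization) = x /\<^sub>R norm x"
definition dist_unitization :: "'a unitization \<Rightarrow> 'a unitization \<Rightarrow> real" where
  "dist (x::'a unitization) y = norm (x - y)"
definition uniformity_unitization :: "('a unitization \<times> 'a unitization) filter" where
  "uniformity = (INF e\<in>{0 <..}. principal {(x::'a unitization, y). dist x y < e})"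
definition open_unitization :: "'a unitization set \<Rightarrow> bool" where
  "open (U :: 'a unitization set) = (\<forall>x\<in>U. eventually (\<lambda>(x', y). x' = x \<longrightarrow> y \<in> U) uniformity)"

instance
proof
  fix x y :: "'a unitization" and r :: real
  show "dist x y = norm (x - y)" by (rule dist_unitization_def)
  show "sgn x = x /\<^sub>R norm x" by (rule sgn_unitization_def)
  show "uniformity = (INF e\<in>{0 <..}. principal {(x, y). dist (x::'a unitization) y < e})"
    by (rule uniformity_unitization_def)
  show "open U = (\<forall>x\<in>U. eventually (\<lambda>(x', y). x' = x \<longrightarrow> y \<in> U) uniformity)"
    for U :: "'a unitization set"
    by (rule open_unitization_def)
  have pos: "0 \<le> onorm (left_mult z)" for z :: "'a unitization"
    by (rule onorm_pos_le[OF bounded_linear_left_mult])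
  show "norm x = 0 \<longleftrightarrow> x = 0"
  proof
    assume 0: "norm x = 0"
    then have s: "scalar_part x = 0"
      by (simp add: norm_unitization_def max_def split: if_splits)
    have "x = Unitization (alg_part x) 0"
      using s by (simp add: unitization_eq_iff)
    then have "onorm (left_mult x) = norm (alg_part x)"
      by (metis onorm_left_mult_alg)
    with 0 s show "x = 0"
      by (simp add: norm_unitization_def unitization_eq_iff unitization_defs)
  next
    assume "x = 0"
    then show "norm x = 0"
      using onorm_left_mult_alg[of "0::'a"] by (simp add: norm_unitization_def unitization_defs)
  qed
  have "onorm (left_mult (x + y)) \<le> onorm (left_mult x) + onorm (left_mult y)"
    using onorm_triangle[OF bounded_linear_left_mult bounded_linear_left_mult, of x y]
    unfolding left_mult_add[symmetric] .
  moreover have "cmod (scalar_part (x + y)) \<le> cmod (scalar_part x) + cmod (scalar_part y)"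
    by (simp add: unitization_defs norm_triangle_ineq)
  ultimately show "norm (x + y) \<le> norm x + norm y"
    unfolding norm_unitization_def by linarith
  have "left_mult (r *\<^sub>R x) = (\<lambda>b. r *\<^sub>R left_mult x b)"
    by (auto simp: scaleR_scaleC left_mult_scaleC)
  then have "onorm (left_mult (r *\<^sub>R x)) = \<bar>r\<bar> * onorm (left_mult x)"
    using onorm_scaleR[OF bounded_linear_left_mult, of r x] by simp
  then show "norm (r *\<^sub>R x) = \<bar>r\<bar> * norm x"
    by (simp add: norm_unitization_def scaleR_unitization_def max_mult_distrib_left)
  have "onorm (left_mult (x * y)) \<le> onorm (left_mult x) * onorm (left_mult y)"
    using onorm_compose[OF bounded_linear_left_mult bounded_linear_left_mult, of x y]
    unfolding o_def left_mult_mult[symmetric] .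
  also have "\<dots> \<le> norm x * norm y"
    using pos by (intro mult_mono) (auto simp: norm_unitization_def max_def)
  finally have "onorm (left_mult (x * y)) \<le> norm x * norm y" .
  moreover have "cmod (scalar_part (x * y)) \<le> norm x * norm y"
    unfolding norm_unitization_def
    using pos[of x] by (auto simp: times_unitization_def norm_mult max_def intro!: mult_mono)
  ultimately show "norm (x * y) \<le> norm x * norm y"
    unfolding norm_unitization_def[of "x * y"] by simp
  have "onorm (left_mult (1::'a unitization)) \<le> 1"
    by (rule onorm_bound) (auto simp: left_mult_def unitization_defs)
  then show "norm (1::'a unitization) = 1"
    by (simp add: norm_unitization_def one_unitization_def)
qed

end

lemma norm_unitization_alg [simp]: "norm (Unitization a 0) = norm a"
  by (simp add: norm_unitization_def onorm_left_mult_alg)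

lemma norm_scalar_part_le: "cmod (scalar_part x) \<le> norm x"
  by (simp add: norm_unitization_def)

lemma norm_unitization_scalar_le: "norm (Unitization (0::'a::cstar_algebra) c) \<le> cmod c"
  unfolding norm_unitization_def
  by (auto intro!: onorm_bound simp: left_mult_def norm_scaleC)

lemma unitization_split:
  "x = Unitization (alg_part x) 0 + Unitization (0::'a::cstar_algebra) (scalar_part x)"
  by (simp add: unitization_defs)

text \<open>Together with \<open>norm_scalar_part_le\<close> and \<open>norm_alg_part_le\<close>
  this makes the norm equivalent to the sum of the component norms, so completeness can be checked
  componentwise.\<close>

lemma norm_unitization_le: "norm x \<le> norm (alg_part x) + cmod (scalar_part x)"
  for x :: "'a::cstar_algebra unitization"
  using norm_triangle_mono[OF order_refl norm_unitization_scalar_le,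
      of "Unitization (alg_part x) 0" "scalar_part x"]
  unfolding unitization_split[symmetric] by simp

lemma norm_alg_part_le: "norm (alg_part x) \<le> 2 * norm x"
  for x :: "'a::cstar_algebra unitization"
proof -
  have "Unitization (alg_part x) 0 = x - Unitization 0 (scalar_part x)"
    by (simp add: unitization_defs unitization_eq_iff)
  then have "norm (alg_part x) = norm (x - Unitization 0 (scalar_part x))"
    by (metis norm_unitization_alg)
  also have "\<dots> \<le> norm x + cmod (scalar_part x)"
    by (rule order_trans[OF norm_triangle_ineq4 add_left_mono[OF norm_unitization_scalar_le]])
  finally show ?thesis using norm_scalar_part_le[of x] by simp
qed

instance unitization :: (cstar_algebra) banach
proof
  fix X :: "nat \<Rightarrow> 'a unitization"
  assume X: "Cauchy X"
  have a: "Cauchy (\<lambda>n. alg_part (X n))"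
  proof (rule metric_CauchyI)
    fix e :: real assume "e > 0"
    with X obtain N where N: "\<forall>m\<ge>N. \<forall>n\<ge>N. dist (X m) (X n) < e / 2"
      unfolding Cauchy_def by (metis half_gt_zero)
    have "dist (alg_part (X m)) (alg_part (X n)) < e" if "m \<ge> N" "n \<ge> N" for m n
      using N[rule_format, OF that] norm_alg_part_le[of "X m - X n"]
      by (simp add: dist_norm unitization_defs)
    then show "\<exists>N. \<forall>m\<ge>N. \<forall>n\<ge>N. dist (alg_part (X m)) (alg_part (X n)) < e" by blast
  qed
  have s: "Cauchy (\<lambda>n. scalar_part (X n))"
  proof (rule metric_CauchyI)
    fix e :: real assume "e > 0"
    with X obtain N where N: "\<forall>m\<ge>N. \<forall>n\<ge>N. dist (X m) (X n) < e"
      unfolding Cauchy_def by blast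
    have "dist (scalar_part (X m)) (scalar_part (X n)) < e" if "m \<ge> N" "n \<ge> N" for m n
      using N[rule_format, OF that] norm_scalar_part_le[of "X m - X n"]
      by (simp add: dist_norm unitization_defs)
    then show "\<exists>N. \<forall>m\<ge>N. \<forall>n\<ge>N. dist (scalar_part (X m)) (scalar_part (X n)) < e" by blast
  qed
  obtain A where A: "(\<lambda>n. alg_part (X n)) \<longlonglongrightarrow> A"
    using a Cauchy_convergent_iff convergent_def by blast
  obtain S where S: "(\<lambda>n. scalar_part (X n)) \<longlonglongrightarrow> S"
    using s Cauchy_convergent_iff convergent_def by blast
  have lim: "(\<lambda>n. norm (alg_part (X n) - A) + cmod (scalar_part (X n) - S)) \<longlonglongrightarrow> 0"
    by (intro tendsto_add_zero tendsto_norm_zero LIM_zero A S)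
  have "norm (X n - Unitization A S) \<le> norm (alg_part (X n) - A) + cmod (scalar_part (X n) - S)" for n
    using norm_unitization_le[of "X n - Unitization A S"] by (simp add: unitization_defs)
  then have "\<forall>\<^sub>F n in sequentially. norm (X n - Unitization A S)
      \<le> norm (alg_part (X n) - A) + cmod (scalar_part (X n) - S)"
    by (intro always_eventually allI)
  from Lim_null_comparison[OF this lim]
  have "(\<lambda>n. X n - Unitization A S) \<longlonglongrightarrow> 0" .
  then have "X \<longlonglongrightarrow> Unitization A S" by (rule LIM_zero_cancel)
  then show "convergent X" by (rule convergentI)
qed

instantiation unitization :: (cstar_algebra) cstar_algebra
begin

definition star_unitization :: "'a unitization \<Rightarrow> 'a unitization" where
  "star x = Unitization (star (alg_part x)) (cnj (scalar_part x))"

instance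
proof
  fix x y :: "'a unitization" and c :: complex
  show "(c *\<^sub>C x) * y = c *\<^sub>C (x * y)" "x * (c *\<^sub>C y) = c *\<^sub>C (x * y)"
    by (simp_all add: unitization_defs mult_scaleC_left mult_scaleC_right scaleC_add_right
        scaleC_scaleC mult_ac)
  show "star (star x) = x" "star (x + y) = star x + star y" "star (c *\<^sub>C x) = cnj c *\<^sub>C star x"
    by (simp_all add: star_unitization_def unitization_defs star_star star_add star_scaleC)
  show mult: "star (x * y) = star y * star x" for x y :: "'a unitization"
    by (simp add: star_unitization_def unitization_defs star_mult star_add star_scaleC add_ac)
  have star_star': "star (star x) = x" for x :: "'a unitization"
    by (simp add: star_unitization_def star_star)
  have pos: "0 \<le> onorm (left_mult z)" for z :: "'a unitization"
    by (rule onorm_pos_le[OF bounded_linear_left_mult])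
  have scale: "onorm (left_mult (d *\<^sub>C z)) \<le> cmod d * onorm (left_mult z)" for d and z :: "'a unitization"
  proof (rule onorm_bound)
    show "norm (left_mult (d *\<^sub>C z) b) \<le> cmod d * onorm (left_mult z) * norm b" for b
      using mult_left_mono[OF norm_left_mult[of z b], of "cmod d"]
      by (simp add: left_mult_scaleC norm_scaleC mult.assoc)
  qed (use pos in simp)
  have scale': "norm (d *\<^sub>C z) \<le> cmod d * norm z" for d and z :: "'a unitization"
    unfolding norm_unitization_def
  proof (rule max.boundedI)
    show "onorm (left_mult (d *\<^sub>C z)) \<le> cmod d * max (onorm (left_mult z)) (cmod (scalar_part z))"
      by (rule order_trans[OF scale]) (simp add: mult_left_mono)
    show "cmod (scalar_part (d *\<^sub>C z)) \<le> cmod d * max (onorm (left_mult z)) (cmod (scalar_part z))"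
      by (simp add: scaleC_unitization_def norm_mult mult_left_mono)
  qed
  \<comment> \<open>The inequality \<open>scale'\<close> is applied twice, to \<open>c\<close> and
    to \<open>inverse c\<close>.\<close>
  show "norm (c *\<^sub>C x) = cmod c * norm x"
  proof (cases "c = 0")
    case False
    have "norm x = norm (inverse c *\<^sub>C c *\<^sub>C x)" using False by (simp add: scaleC_scaleC)
    also have "\<dots> \<le> inverse (cmod c) * norm (c *\<^sub>C x)"
      using scale'[of "inverse c" "c *\<^sub>C x"] by (simp add: norm_inverse)
    finally have "cmod c * norm x \<le> norm (c *\<^sub>C x)"
      using False by (simp add: field_simps)
    with scale'[of c x] show ?thesis by simp
  qed simp
  \<comment> \<open>The C*-identity of the original algebra at \<open>left_mult z b\<close> moves
    \<open>star z\<close> next to \<open>z\<close>, leaving only \<open>star b\<close>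
    outside.\<close>
  have le: "(onorm (left_mult z))\<^sup>2 \<le> onorm (left_mult (star z * z))" for z :: "'a unitization"
  proof -
    have "norm (left_mult z b) \<le> sqrt (onorm (left_mult (star z * z))) * norm b" for b
    proof (rule power2_le_imp_le)
      have "star (left_mult z b) = star b * star (alg_part z) + cnj (scalar_part z) *\<^sub>C star b"
        by (simp add: left_mult_def star_add star_mult star_scaleC)
      then have "star (left_mult z b) * left_mult z b = star b * left_mult (star z * z) b"
        by (simp add: left_mult_mult) (simp add: left_mult_def star_unitization_def algebra_simps
          mult_scaleC_left mult_scaleC_right scaleC_add_right scaleC_scaleC)
      then have "(norm (left_mult z b))\<^sup>2 = norm (star b * left_mult (star z * z) b)"
        by (metis cstar_identity)
      also have "\<dots> \<le> norm b * (onorm (left_mult (star z * z)) * norm b)"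
        by (rule order_trans[OF norm_mult_ineq]) (auto intro!: mult_left_mono norm_left_mult)
      finally show "(norm (left_mult z b))\<^sup>2 \<le> (sqrt (onorm (left_mult (star z * z))) * norm b)\<^sup>2"
        using pos by (simp add: power_mult_distrib power2_eq_square mult_ac)
    qed (use pos in simp)
    then have "onorm (left_mult z) \<le> sqrt (onorm (left_mult (star z * z)))"
      by (rule onorm_bound[rotated]) (use pos in simp)
    from power_mono[OF this pos, of 2] show ?thesis
      using pos[of "star z * z"] by simp
  qed
  have sc: "cmod (scalar_part (star z * z)) = (cmod (scalar_part z))\<^sup>2" for z :: "'a unitization"
    by (simp add: star_unitization_def unitization_defs norm_mult power2_eq_square)
  have ge: "(norm z)\<^sup>2 \<le> norm (star z * z)" for z :: "'a unitization"
  proof -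
    have "norm z = onorm (left_mult z) \<or> norm z = cmod (scalar_part z)"
      by (auto simp: norm_unitization_def)
    then show ?thesis
      using le[of z] sc[of z] unfolding norm_unitization_def[of "star z * z"]
      by (elim disjE) (simp_all add: le_max_iff_disj)
  qed
  have star_le: "norm z \<le> norm (star z)" for z :: "'a unitization"
  proof (cases "norm z = 0")
    case False
    have "norm z * norm z \<le> norm (star z) * norm z"
      using order_trans[OF ge[of z] norm_mult_ineq] by (simp add: power2_eq_square)
    then show ?thesis using False by simp
  next
    case True
    then show ?thesis by (metis norm_ge_zero)
  qed
  have "norm (star x * x) \<le> norm (star x) * norm x"
    by (rule norm_mult_ineq)
  also have "\<dots> \<le> norm x * norm x"
    using star_le[of "star x"] unfolding star_star' by (rule mult_right_mono) (rule norm_ge_zero)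
  finally have "norm (star x * x) \<le> norm x * norm x" .
  with ge[of x] show "norm (star x * x) = (norm x)\<^sup>2"
    by (simp add: power2_eq_square)
qed

end

text \<open>The multiplication of pairs used for \<open>spectrum\<close> is that of the type
  \<open>unitization\<close>, so both notions of spectrum agree. Through this bridge the order facts
  descend to algebras without a unit.\<close>

lemma cstar_positive_iff: "cstar_positive a \<longleftrightarrow> positive (Unitization a 0)"
proof -
  have 1: "unitization_mult (a, - l) (b, c) = (0, 1) \<and> unitization_mult (b, c) (a, - l) = (0, 1) \<longleftrightarrow>
      is_inverse (Unitization a 0 - l *\<^sub>C 1) (Unitization b c)" for l b c
    by (simp add: is_inverse_def unitization_mult_def unitization_defs)
  have 2: "(\<exists>y. P y) \<longleftrightarrow> (\<exists>b c. P (Unitization b c))" for P :: "'a unitization \<Rightarrow> bool"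
    by (metis unitization.exhaust)
  have "(\<exists>y. unitization_mult (a, - l) y = (0, 1) \<and> unitization_mult y (a, - l) = (0, 1)) \<longleftrightarrow>
      (\<exists>y. is_inverse (Unitization a 0 - l *\<^sub>C 1) y)" for l
    unfolding split_paired_Ex 1 2[of "is_inverse _"] ..
  then have "spectrum a = unital_spectrum (Unitization a 0)"
    by (simp add: spectrum_def unital_spectrum_def)
  then show ?thesis
    by (simp add: cstar_positive_def positive_def star_unitization_def)
qed

lemma Unitization_alg_hom:
  fixes a b :: "'a::cstar_algebra"
  shows "Unitization a 0 + Unitization b 0 = Unitization (a + b) 0"
    "Unitization a 0 - Unitization b 0 = Unitization (a - b) 0"
    "Unitization a 0 * Unitization b 0 = Unitization (a * b) 0"
    "r *\<^sub>R Unitization a 0 = Unitization (r *\<^sub>R a) 0"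
    "star (Unitization a 0) = Unitization (star a) 0"
  by (simp_all add: unitization_defs star_unitization_def)

lemma cstar_positive_add: "cstar_positive a \<Longrightarrow> cstar_positive b \<Longrightarrow> cstar_positive (a + b)"
  using positive_add[of "Unitization a 0" "Unitization b 0"]
  by (simp add: cstar_positive_iff Unitization_alg_hom)

lemma cstar_positive_scaleR: "cstar_positive a \<Longrightarrow> r \<ge> 0 \<Longrightarrow> cstar_positive (r *\<^sub>R a)"
  using positive_scaleR[of "Unitization a 0" r]
  by (simp add: cstar_positive_iff Unitization_alg_hom)

lemma cstar_positive_zero: "cstar_positive (0::'a::cstar_algebra)"
  using positive_square[of "0::'a unitization"]
  by (simp add: cstar_positive_iff flip: zero_unitization_def)

lemma cstar_positive_sum:
  "(\<And>i. i \<in> I \<Longrightarrow> cstar_positive (f i)) \<Longrightarrow> cstar_positive (\<Sum>i\<in>I. f i)"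
  by (induction I rule: infinite_finite_induct) (auto simp: cstar_positive_add cstar_positive_zero)

lemma cstar_positive_norm_mono: "cstar_positive a \<Longrightarrow> cstar_positive (b - a) \<Longrightarrow> norm a \<le> norm b"
  using norm_mono_positive[of "Unitization a 0" "Unitization b 0"]
  by (simp add: cstar_positive_iff Unitization_alg_hom)

lemma cstar_positive_diff_star_mult:
  "cstar_positive (a - star b * b) \<Longrightarrow> (norm b)\<^sup>2 \<le> norm a"
  using norm_le_if_star_mult_le[of "Unitization a 0" "Unitization b 0"]
  by (simp add: cstar_positive_iff Unitization_alg_hom)

subsection \<open>Semi-inner product modules\<close>

lemma seminorm_nonneg [simp]: "0 \<le> seminorm ip x"
  by (simp add: seminorm_def)

lemma seminorm_squared: "(seminorm ip x)\<^sup>2 = norm (ip x x)"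
  by (simp add: seminorm_def)

lemma norm_star_mult_mult_le: "norm (star b * c * b) \<le> norm b * norm c * norm (b::'a::cstar_algebra)"
proof -
  have "norm (star b * c * b) \<le> norm (star b * c) * norm b"
    by (rule norm_mult_ineq)
  also have "\<dots> \<le> norm b * norm c * norm b"
    using norm_mult_ineq[of "star b" c] by (intro mult_right_mono) simp_all
  finally show ?thesis .
qed

context semi_inner_product_module
begin

lemma ip_add_left: "ip (x + y) z = ip x z + ip y z"
  by (metis ip_add_right ip_star star_add)

text \<open>Homogeneity is not an axiom. Scalars can be moved through the action onto the algebra
  element, so the defect \<open>d\<close> satisfies \<open>d * a = 0\<close> for all
  \<open>a\<close>. Without a unit to insert for \<open>a\<close>, the choice \<open>star d\<close>
  and the C*-identity give \<open>d = 0\<close>.\<close>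

lemma ip_scaleC_right: "ip x (c *\<^sub>C y) = c *\<^sub>C ip x y"
proof -
  define d where "d = ip x (c *\<^sub>C y) - c *\<^sub>C ip x y"
  have "ip x (c *\<^sub>C y) * a = (c *\<^sub>C ip x y) * a" for a
    by (metis act_scaleC_left act_scaleC_right ip_act_right mult_scaleC_left mult_scaleC_right)
  then have "d * star d = 0"
    by (simp add: d_def left_diff_distrib)
  then have "norm (star d) = 0"
    using cstar_identity[of "star d"] by (simp add: star_star)
  then show ?thesis by (simp add: d_def)
qed

lemma ip_scaleC_left: "ip (c *\<^sub>C x) y = cnj c *\<^sub>C ip x y"
  by (metis ip_scaleC_right ip_star star_scaleC)

lemma ip_scaleR_right: "ip x (r *\<^sub>R y) = r *\<^sub>R ip x y"
  by (simp add: scaleR_scaleC ip_scaleC_right)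

lemma ip_scaleR_left: "ip (r *\<^sub>R x) y = r *\<^sub>R ip x y"
  by (simp add: scaleR_scaleC ip_scaleC_left)

lemma ip_zero_right [simp]: "ip x 0 = 0"
  using ip_scaleR_right[of x 0 0] by simp

lemma ip_zero_left [simp]: "ip 0 x = 0"
  using ip_scaleR_left[of 0 0 x] by simp

lemma ip_minus_right: "ip x (- y) = - ip x y"
  using ip_scaleR_right[of x "- 1" y] by simp

lemma ip_minus_left: "ip (- x) y = - ip x y"
  using ip_scaleR_left[of "- 1" x y] by simp

lemma ip_diff_right: "ip x (y - z) = ip x y - ip x z"
  using ip_add_right[of x y "- z"] by (simp add: ip_minus_right)

lemma ip_diff_left: "ip (x - y) z = ip x z - ip y z"
  using ip_add_left[of x "- y" z] by (simp add: ip_minus_left)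

lemma ip_sum_right: "ip x (\<Sum>i\<in>I. f i) = (\<Sum>i\<in>I. ip x (f i))"
  by (induction I rule: infinite_finite_induct) (auto simp: ip_add_right)

lemma ip_sum_left: "ip (\<Sum>i\<in>I. f i) y = (\<Sum>i\<in>I. ip (f i) y)"
  by (induction I rule: infinite_finite_induct) (auto simp: ip_add_left)

lemma ip_act_left: "ip (act x a) y = star a * ip x y"
  by (metis ip_act_right ip_star star_mult)

lemma act_scaleR_left: "act (r *\<^sub>R x) a = r *\<^sub>R act x a"
  by (simp add: scaleR_scaleC act_scaleC_left)

lemma act_zero_left [simp]: "act 0 a = 0"
  using act_scaleR_left[of 0 0 a] by simp

lemma act_sum_left: "act (\<Sum>i\<in>I. f i) a = (\<Sum>i\<in>I. act (f i) a)"
  by (induction I rule: infinite_finite_induct) (auto simp: act_add_left)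

text \<open>Positivity at \<open>y - t x\<langle>x,y\<rangle>\<close> with \<open>t = \<parallel>x\<parallel>\<^sup>-\<^sup>2\<close>; if \<open>\<parallel>x\<parallel> = 0\<close>, then
  \<open>t\<close> can be arbitrarily large.\<close>

lemma Cauchy_Schwarz: "norm (ip x y) \<le> seminorm ip x * seminorm ip y"
proof -
  define b where "b = ip x y"
  define C where "C = norm (ip x x)"
  define D where "D = norm (ip y y)"
  define N where "N = (norm b)\<^sup>2"
  have key: "2 * t * N \<le> D + t\<^sup>2 * (C * N)" if t: "t \<ge> 0" for t :: real
  proof -
    \<comment> \<open>Chosen so that the two equal cross terms combine into
      \<open>star (s *\<^sub>R b) * (s *\<^sub>R b)\<close>, the form required by
      \<open>cstar_positive_diff_star_mult\<close>.\<close>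
    define s where "s = sqrt (2 * t)"
    have ss: "s * s = 2 * t" using t by (simp add: s_def)
    define w where "w = y - t *\<^sub>R act x b"
    have yx: "ip y x = star b" by (simp add: b_def ip_star)
    have "star (s *\<^sub>R b) * (s *\<^sub>R b) = (2 * t) *\<^sub>R (star b * b)"
      by (simp add: star_scaleR ss)
    also have "\<dots> = t *\<^sub>R (star b * b) + t *\<^sub>R (star b * b)"
      by (simp flip: scaleR_add_left)
    finally have two: "star (s *\<^sub>R b) * (s *\<^sub>R b) = t *\<^sub>R (star b * b) + t *\<^sub>R (star b * b)" .
    have "ip w w = (ip y y + t\<^sup>2 *\<^sub>R (star b * ip x x * b)) - star (s *\<^sub>R b) * (s *\<^sub>R b)"
      unfolding two
      by (simp add: w_def ip_diff_left ip_diff_right ip_scaleR_left ip_scaleR_right ip_act_left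
          ip_act_right yx b_def[symmetric] power2_eq_square scaleR_diff_right algebra_simps)
    with ip_positive[of w]
    have "(norm (s *\<^sub>R b))\<^sup>2 \<le> norm (ip y y + t\<^sup>2 *\<^sub>R (star b * ip x x * b))"
      by (intro cstar_positive_diff_star_mult) simp
    also have "\<dots> \<le> D + t\<^sup>2 * norm (star b * ip x x * b)"
      unfolding D_def by (rule norm_triangle_le) simp
    also have "\<dots> \<le> D + t\<^sup>2 * (C * N)"
      using norm_star_mult_mult_le[of b "ip x x"]
      by (intro add_left_mono mult_left_mono) (simp_all add: C_def N_def power2_eq_square mult_ac)
    also have "(norm (s *\<^sub>R b))\<^sup>2 = 2 * t * N"
      using ss by (simp add: N_def power_mult_distrib power2_eq_square)
    finally show ?thesis .
  qed
  have CDN: "C \<ge> 0" "D \<ge> 0" "N \<ge> 0" by (simp_all add: C_def D_def N_def)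
  have "N \<le> C * D"
  proof (cases "C = 0")
    case True
    have "N = 0"
    proof (rule ccontr)
      assume "N \<noteq> 0"
      \<comment> \<open>At this \<open>t\<close> the inequality \<open>key\<close> reads
        \<open>D + 1 \<le> D\<close>.\<close>
      with CDN key[of "(D + 1) / (2 * N)"] True show False by simp
    qed
    then show ?thesis using True by simp
  next
    case False
    with CDN have C: "C > 0" by simp
    have "2 * N \<le> D * C + N"
      using key[of "1 / C"] C by (simp add: field_simps power2_eq_square)
    then show ?thesis by (simp add: mult.commute)
  qed
  also have "\<dots> = (seminorm ip x * seminorm ip y)\<^sup>2"
    by (simp add: C_def D_def power_mult_distrib seminorm_squared)
  finally show ?thesis
    unfolding N_def b_def by (rule power2_le_imp_le) simp
qed

lemma seminorm_triangle: "seminorm ip (x + y) \<le> seminorm ip x + seminorm ip y"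
proof (rule power2_le_imp_le)
  have "(seminorm ip (x + y))\<^sup>2 = norm ((ip x x + ip x y) + (ip y x + ip y y))"
    by (simp add: seminorm_squared ip_add_left ip_add_right add_ac)
  also have "\<dots> \<le> (norm (ip x x) + norm (ip x y)) + (norm (ip y x) + norm (ip y y))"
    by (intro norm_triangle_mono order_refl)
  also have "\<dots> \<le> ((seminorm ip x)\<^sup>2 + seminorm ip x * seminorm ip y)
      + (seminorm ip y * seminorm ip x + (seminorm ip y)\<^sup>2)"
    by (intro add_mono Cauchy_Schwarz) (simp_all add: seminorm_squared)
  also have "\<dots> = (seminorm ip x + seminorm ip y)\<^sup>2"
    by (simp add: power2_eq_square algebra_simps)
  finally show "(seminorm ip (x + y))\<^sup>2 \<le> (seminorm ip x + seminorm ip y)\<^sup>2" .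
qed simp

lemma seminorm_scaleR: "seminorm ip (r *\<^sub>R x) = \<bar>r\<bar> * seminorm ip x"
  by (simp add: seminorm_def ip_scaleR_left ip_scaleR_right real_sqrt_mult flip: mult.assoc)

lemma seminorm_diff: "seminorm ip (x - y) \<le> seminorm ip x + seminorm ip y"
  using seminorm_triangle[of x "(- 1) *\<^sub>R y"] seminorm_scaleR[of "- 1" y] by simp

lemma seminorm_act: "seminorm ip (act x a) \<le> seminorm ip x * norm a"
proof (rule power2_le_imp_le)
  have "norm (ip (act x a) (act x a)) \<le> norm a * norm (ip x x) * norm a"
    unfolding ip_act_left ip_act_right mult.assoc[symmetric]
    by (rule norm_star_mult_mult_le)
  then show "(seminorm ip (act x a))\<^sup>2 \<le> (seminorm ip x * norm a)\<^sup>2"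
    by (simp add: seminorm_squared power_mult_distrib power2_eq_square[of "norm a"] mult_ac)
qed simp

section \<open>Bounded maps and Frechet derivatives\<close>

lemma bounded_clinear_act: "bounded_clinear ip (act x)"
  unfolding bounded_clinear_def using seminorm_act act_add_right act_scaleC_right by blast

lemma bounded_clinear_diff:
  assumes "bounded_clinear ip u" "bounded_clinear ip v"
  shows "bounded_clinear ip (\<lambda>a. u a - v a)"
proof -
  from assms obtain K L where K: "\<And>a. seminorm ip (u a) \<le> K * norm a"
    and L: "\<And>a. seminorm ip (v a) \<le> L * norm a"
    unfolding bounded_clinear_def by blast
  have "seminorm ip (u a - v a) \<le> (K + L) * norm a" for a
    using seminorm_diff[of "u a" "v a"] K[of a] L[of a] by (simp add: distrib_right)
  with assms show ?thesis
    unfolding bounded_clinear_def by (auto simp: scaleC_diff_right)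
qed

lemma seminorm_le_op_norm:
  assumes u: "bounded_clinear ip u"
  shows "seminorm ip (u a) \<le> op_norm ip u * norm a"
proof -
  have scale: "u (r *\<^sub>R b) = r *\<^sub>R u b" for r b
    using u by (simp add: bounded_clinear_def scaleR_scaleC)
  from u obtain K where K: "\<And>a. seminorm ip (u a) \<le> K * norm a"
    unfolding bounded_clinear_def by blast
  \<comment> \<open>The supremum in \<open>op_norm\<close> is informative only once the set is known
    to be bounded above. The absolute value matters because \<open>K\<close> may be negative in the
    zero algebra.\<close>
  have "seminorm ip (u b) \<le> \<bar>K\<bar>" if "b \<in> cball 0 1" for b
  proof -
    have "K * norm b \<le> \<bar>K\<bar> * 1"
      using that by (intro mult_mono) auto
    then show ?thesis using K[of b] by simp
  qed
  then have bdd: "bdd_above ((\<lambda>b. seminorm ip (u b)) ` cball 0 1)"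
    by (intro bdd_aboveI2)
  show ?thesis
  proof (cases "a = 0")
    case True
    then show ?thesis using K[of 0] by simp
  next
    case False
    have "seminorm ip (u (inverse (norm a) *\<^sub>R a)) \<le> op_norm ip u"
      unfolding op_norm_def using False by (intro cSUP_upper bdd) simp
    then show ?thesis
      using False by (simp add: scale seminorm_scaleR field_simps)
  qed
qed

text \<open>Along the multiples \<open>1/(n+1)\<close> of \<open>a\<close> the quotient of
  \<open>u - v\<close> is constant by linearity, yet bounded by two remainders tending to 0. Only
  the seminorm of the difference is forced to vanish.\<close>

lemma frechet_derivative_unique:
  assumes u: "has_frechet_derivative ip f q u" and v: "has_frechet_derivative ip f q v"
  shows "seminorm ip (u a - v a) = 0"
proof (cases "a = 0")
  case True
  then have "u a = 0" "v a = 0"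
    using u v unfolding has_frechet_derivative_def bounded_clinear_def
    by (metis add_cancel_left_right)+
  then show ?thesis by (simp add: seminorm_def)
next
  case False
  define R where "R w h = seminorm ip (f (q + h) - f q - w h) / norm h" for w h
  have "(R u \<longlongrightarrow> 0) (at 0)" "(R v \<longlongrightarrow> 0) (at 0)"
    using u v unfolding has_frechet_derivative_def R_def by auto
  then have lim: "((\<lambda>h. R v h + R u h) \<longlongrightarrow> 0) (at 0)"
    by (intro tendsto_add_zero)
  define h where "h n = inverse (real (Suc n)) *\<^sub>R a" for n
  have "h \<longlonglongrightarrow> 0 *\<^sub>R a"
    unfolding h_def by (intro tendsto_scaleR LIMSEQ_inverse_real_of_nat tendsto_const)
  then have "filterlim h (at 0) sequentially"
    using False by (simp add: filterlim_at h_def)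
  from filterlim_compose[OF lim this] have "(\<lambda>n. R v (h n) + R u (h n)) \<longlonglongrightarrow> 0" .
  moreover have "seminorm ip (u a - v a) / norm a \<le> R v (h n) + R u (h n)" for n
  proof -
    have "u (h n) = inverse (real (Suc n)) *\<^sub>R u a" "v (h n) = inverse (real (Suc n)) *\<^sub>R v a"
      using u v by (simp_all add: has_frechet_derivative_def bounded_clinear_def h_def scaleR_scaleC)
    then have "u (h n) - v (h n) = inverse (real (Suc n)) *\<^sub>R (u a - v a)"
      by (simp add: scaleR_diff_right)
    then have "seminorm ip (u a - v a) / norm a = seminorm ip (u (h n) - v (h n)) / norm (h n)"
      by (simp add: seminorm_scaleR h_def)
    also have "u (h n) - v (h n) = (f (q + h n) - f q - v (h n)) - (f (q + h n) - f q - u (h n))"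
      by simp
    also have "seminorm ip \<dots> / norm (h n) \<le> R v (h n) + R u (h n)"
      unfolding R_def add_divide_distrib[symmetric] by (intro divide_right_mono seminorm_diff) simp
    finally show ?thesis .
  qed
  ultimately have "seminorm ip (u a - v a) / norm a \<le> 0"
    by (intro LIMSEQ_le_const) auto
  then show ?thesis
    using False seminorm_nonneg[of ip "u a - v a"] by (simp add: divide_le_0_iff)
qed

text \<open>Makes every result of the locale available for the direct sum as well.\<close>

lemma direct_sum_module: "semi_inner_product_module (\<lambda>v a. \<chi> i. act (v $ i) a) (ip_vec ip)"
  by unfold_locales
    (auto simp: vec_eq_iff ip_vec_def act_add_left act_add_right act_act act_scaleC_left
      act_scaleC_right scaleC_vec_def ip_add_right sum.distrib ip_act_right sum_distrib_right
      star_sum ip_star intro!: cstar_positive_sum ip_positive)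

text \<open>The other summands are positive, and the norm is monotone on positive elements.\<close>

lemma seminorm_component_le: "seminorm ip (v $ i) \<le> seminorm (ip_vec ip) v"
proof -
  have "ip_vec ip v v - ip (v $ i) (v $ i) = (\<Sum>j\<in>UNIV - {i}. ip (v $ j) (v $ j))"
    by (simp add: ip_vec_def sum.remove[of UNIV i])
  then have "cstar_positive (ip_vec ip v v - ip (v $ i) (v $ i))"
    by (simp add: cstar_positive_sum ip_positive)
  from cstar_positive_norm_mono[OF ip_positive this] show ?thesis
    by (simp add: seminorm_def)
qed

lemma has_frechet_derivative_component:
  assumes "has_frechet_derivative (ip_vec ip) f q u"
  shows "has_frechet_derivative ip (\<lambda>b. f b $ i) q (\<lambda>a. u a $ i)"
  unfolding has_frechet_derivative_def
proof
  from assms obtain K where K: "\<And>a. seminorm (ip_vec ip) (u a) \<le> K * norm a"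
    unfolding has_frechet_derivative_def bounded_clinear_def by blast
  have "seminorm ip (u a $ i) \<le> K * norm a" for a
    using seminorm_component_le K order_trans by blast
  then show "bounded_clinear ip (\<lambda>a. u a $ i)"
    using assms unfolding has_frechet_derivative_def bounded_clinear_def
    by (auto simp: scaleC_vec_def)
  have le: "norm (seminorm ip (f (q + h) $ i - f q $ i - u h $ i) / norm h)
      \<le> seminorm (ip_vec ip) (f (q + h) - f q - u h) / norm h" for h
    using seminorm_component_le[of "f (q + h) - f q - u h" i] by (simp add: divide_right_mono)
  show "((\<lambda>h. seminorm ip (f (q + h) $ i - f q $ i - u h $ i) / norm h) \<longlongrightarrow> 0) (at 0)"
    by (rule Lim_null_comparison[OF always_eventually[OF allI[OF le]]])
      (use assms in \<open>simp add: has_frechet_derivative_def\<close>)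
qed

subsection \<open>The covariance form\<close>

definition covariance :: "real ^ 'n::finite \<Rightarrow> 'x ^ 'n \<Rightarrow> 'x ^ 'n \<Rightarrow> 'a" where
  "covariance r u v = (\<Sum>i\<in>UNIV. r $ i *\<^sub>R ip (u $ i) (v $ i))
     - ip (\<Sum>i\<in>UNIV. r $ i *\<^sub>R u $ i) (\<Sum>i\<in>UNIV. r $ i *\<^sub>R v $ i)"

text \<open>As the weights sum to 1, the weighted sum and the product of the means change by the
  same three terms, which cancel. The shifts \<open>z\<close> and \<open>w\<close> may
  differ.\<close>

lemma covariance_translate:
  assumes r: "probability_vector r"
  shows "covariance r u v = (\<Sum>i\<in>UNIV. r $ i *\<^sub>R ip (u $ i - z) (v $ i - w))
     - ip ((\<Sum>i\<in>UNIV. r $ i *\<^sub>R u $ i) - z) ((\<Sum>i\<in>UNIV. r $ i *\<^sub>R v $ i) - w)"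
proof -
  have 1: "(\<Sum>i\<in>UNIV. r $ i *\<^sub>R ip z w) = ip z w"
    using r by (simp add: probability_vector_def flip: scaleR_left.sum)
  have "(\<Sum>i\<in>UNIV. r $ i *\<^sub>R ip (u $ i - z) (v $ i - w)) =
      (\<Sum>i\<in>UNIV. r $ i *\<^sub>R ip (u $ i) (v $ i)) - ip (\<Sum>i\<in>UNIV. r $ i *\<^sub>R u $ i) w
      - ip z (\<Sum>i\<in>UNIV. r $ i *\<^sub>R v $ i) + (\<Sum>i\<in>UNIV. r $ i *\<^sub>R ip z w)"
    by (simp add: ip_diff_left ip_diff_right scaleR_diff_right sum.distrib sum_subtractf
        ip_sum_left ip_sum_right ip_scaleR_left ip_scaleR_right)
  then show ?thesis
    by (simp add: 1 covariance_def ip_diff_left ip_diff_right)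
qed

lemma weighted_mean_diff:
  assumes "probability_vector r"
  shows "(\<Sum>i\<in>UNIV. r $ i *\<^sub>R (u $ i - z)) = (\<Sum>i\<in>UNIV. r $ i *\<^sub>R u $ i) - (z::'x)"
  using assms
  by (simp add: probability_vector_def scaleR_diff_right sum_subtractf flip: scaleR_left.sum)

lemma covariance_module:
  fixes r :: "real ^ 'n::finite"
  assumes r: "probability_vector r"
  shows "semi_inner_product_module (\<lambda>v a. \<chi> i. act (v $ i) a) (covariance r)"
proof -
  interpret V: semi_inner_product_module "\<lambda>(v::'x^'n) a. \<chi> i. act (v $ i) a" "ip_vec ip"
    by (rule direct_sum_module)
  show ?thesis
  proof unfold_locales
    show "covariance r u (v + w) = covariance r u v + covariance r u w" for u v w
      by (simp add: covariance_def ip_add_right scaleR_add_right sum.distrib)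
    show "covariance r u (\<chi> i. act (v $ i) a) = covariance r u v * a" for u v a
      by (simp add: covariance_def ip_act_right sum_distrib_right left_diff_distrib
          flip: act_scaleR_left act_sum_left)
    show "star (covariance r u v) = covariance r v u" for u v
      by (simp add: covariance_def star_diff star_sum star_scaleR ip_star)
    show "cstar_positive (covariance r u u)" for u
    proof -
      \<comment> \<open>Centring at the mean makes the subtracted term vanish, leaving a sum of
        positive elements with nonnegative weights.\<close>
      define m where "m = (\<Sum>i\<in>UNIV. r $ i *\<^sub>R u $ i)"
      have "covariance r u u = (\<Sum>i\<in>UNIV. r $ i *\<^sub>R ip (u $ i - m) (u $ i - m))"
        using covariance_translate[OF r, of u u m m] by (simp add: m_def)
      then show ?thesis
        using r by (auto simp: probability_vector_def intro!: cstar_positive_sum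
            cstar_positive_scaleR ip_positive)
    qed
  qed (rule V.act_add_left V.act_add_right V.act_act V.act_scaleC_left V.act_scaleC_right)+
qed

text \<open>The difference of the two forms at \<open>u\<close> consists of the terms with weights
  \<open>1 - r $ i\<close>, which are nonnegative, and the square of the mean. Monotonicity of the
  norm then applies.\<close>

lemma seminorm_covariance_le:
  fixes r :: "real ^ 'n::finite"
  assumes r: "probability_vector r"
  shows "seminorm (covariance r) u \<le> seminorm (ip_vec ip) u"
proof -
  interpret C: semi_inner_product_module "\<lambda>(v::'x^'n) a. \<chi> i. act (v $ i) a" "covariance r"
    by (rule covariance_module[OF r])
  have r1: "r $ i \<le> 1" for i
    using r member_le_sum[of i UNIV "\<lambda>i. r $ i"] by (simp add: probability_vector_def)
  have "ip_vec ip u u - covariance r u u = (\<Sum>i\<in>UNIV. (1 - r $ i) *\<^sub>R ip (u $ i) (u $ i))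
      + ip (\<Sum>i\<in>UNIV. r $ i *\<^sub>R u $ i) (\<Sum>i\<in>UNIV. r $ i *\<^sub>R u $ i)"
    by (simp add: covariance_def ip_vec_def scaleR_diff_left sum_subtractf)
  also have "cstar_positive \<dots>"
    using r1 by (intro cstar_positive_add cstar_positive_sum cstar_positive_scaleR ip_positive) simp
  finally show ?thesis
    using cstar_positive_norm_mono[OF C.ip_positive] by (simp add: seminorm_def)
qed

lemma norm_covariance_le:
  fixes r :: "real ^ 'n::finite"
  assumes r: "probability_vector r"
  shows "norm (covariance r u v) \<le> seminorm (ip_vec ip) (u - (\<chi> i. z)) * seminorm (ip_vec ip) (v - (\<chi> i. w))"
proof -
  interpret C: semi_inner_product_module "\<lambda>(v::'x^'n) a. \<chi> i. act (v $ i) a" "covariance r"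
    by (rule covariance_module[OF r])
  have "covariance r u v = covariance r (u - (\<chi> i. z)) (v - (\<chi> i. w))"
    unfolding covariance_translate[OF r, of u v z w]
    unfolding covariance_def by (simp add: weighted_mean_diff[OF r])
  also have "norm \<dots> \<le> seminorm (covariance r) (u - (\<chi> i. z)) * seminorm (covariance r) (v - (\<chi> i. w))"
    by (rule C.Cauchy_Schwarz)
  also have "\<dots> \<le> seminorm (ip_vec ip) (u - (\<chi> i. z)) * seminorm (ip_vec ip) (v - (\<chi> i. w))"
    by (intro mult_mono seminorm_covariance_le r) simp_all
  finally show ?thesis .
qed

text \<open>The maps \<open>ui i\<close> are arbitrary derivatives of the components of
  \<open>f\<close>. They differ from the components of \<open>u\<close> by elements of seminorm 0,
  which the triangle inequality absorbs, so the operator norm bound for \<open>u\<close> passes to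
  them.\<close>

lemma seminorm_derivative_components_le:
  fixes u :: "'a \<Rightarrow> 'x ^ 'n::finite"
  assumes u: "has_frechet_derivative (ip_vec ip) f p u"
    and ui: "\<And>i. has_frechet_derivative ip (\<lambda>b. f b $ i) p (ui i)"
    and bound: "op_norm (ip_vec ip) (\<lambda>b. u b - hat act x b) \<le> K"
  shows "seminorm (ip_vec ip) ((\<chi> i. ui i a) - (\<chi> i. act x a)) \<le> K * norm a"
proof -
  interpret V: semi_inner_product_module "\<lambda>(v::'x^'n) a. \<chi> i. act (v $ i) a" "ip_vec ip"
    by (rule direct_sum_module)
  have "norm (ip (ui i a - u a $ i) (ui i a - u a $ i)) = 0" for i
    using frechet_derivative_unique[OF ui has_frechet_derivative_component[OF u]]
    by (simp add: seminorm_def)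
  then have 0: "seminorm (ip_vec ip) ((\<chi> i. ui i a) - u a) = 0"
    by (simp add: seminorm_def ip_vec_def)
  \<comment> \<open>In the direct sum \<open>hat act x\<close> is the action on the constant vector
    with entries \<open>x\<close>.\<close>
  have "bounded_clinear (ip_vec ip) (hat act x :: 'a \<Rightarrow> 'x ^ 'n)"
    using V.bounded_clinear_act[of "\<chi> i. x"] by (simp add: hat_def[abs_def])
  then have "bounded_clinear (ip_vec ip) (\<lambda>b. u b - hat act x b)"
    using u unfolding has_frechet_derivative_def by (blast intro: V.bounded_clinear_diff)
  from V.seminorm_le_op_norm[OF this, of a]
  have "seminorm (ip_vec ip) (u a - hat act x a) \<le> K * norm a"
    using bound by (meson mult_right_mono norm_ge_zero order_trans)
  moreover have "(\<chi> i. ui i a) - (\<chi> i. act x a) = ((\<chi> i. ui i a) - u a) + (u a - hat act x a)"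
    by (simp add: hat_def)
  ultimately show ?thesis
    using V.seminorm_triangle[of "(\<chi> i. ui i a) - u a" "u a - hat act x a"] 0 by simp
qed

end

theorem lemma2:
  fixes act :: "'x::complex_vector \<Rightarrow> 'a::cstar_algebra \<Rightarrow> 'x"
    and ip :: "'x \<Rightarrow> 'x \<Rightarrow> 'a"
    and x0 y0 x1 y1 :: 'x
    and r :: "real ^ 'n::finite"
    and p :: 'a
    and f g Df Dg :: "'a \<Rightarrow> 'x ^ 'n"
    and Dfi Dgi :: "'n \<Rightarrow> 'a \<Rightarrow> 'x"
  assumes module: "semi_inner_product_module act ip"
    and r: "probability_vector r"
    and f: "f \<in> diff_near (ip_vec ip) p"
    and g: "g \<in> diff_near (ip_vec ip) p"
    and Df: "has_frechet_derivative (ip_vec ip) f p Df"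
    and Dg: "has_frechet_derivative (ip_vec ip) g p Dg"
    and Dfi: "\<And>i. has_frechet_derivative ip (\<lambda>b. f b $ i) p (Dfi i)"
    and Dgi: "\<And>i. has_frechet_derivative ip (\<lambda>b. g b $ i) p (Dgi i)"
    and Df_bound: "op_norm (ip_vec ip) (\<lambda>b. Df b - hat act ((1/2) *\<^sub>R (x0 + y0)) b)
                     \<le> seminorm ip ((1/2) *\<^sub>R (x0 - y0))"
    and Dg_bound: "op_norm (ip_vec ip) (\<lambda>b. Dg b - hat act ((1/2) *\<^sub>R (x1 + y1)) b)
                     \<le> seminorm ip ((1/2) *\<^sub>R (x1 - y1))"
  shows "\<forall>a. norm ((\<Sum>i\<in>UNIV. r $ i *\<^sub>R ip (Dfi i a) (Dgi i a))
                   - ip (\<Sum>i\<in>UNIV. r $ i *\<^sub>R Dfi i a) (\<Sum>i\<in>UNIV. r $ i *\<^sub>R Dgi i a))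
             \<le> 1/4 * seminorm ip (x0 - y0) * seminorm ip (x1 - y1) * (norm a)\<^sup>2"
proof
  fix a
  interpret semi_inner_product_module act ip by (rule module)
  let ?u = "\<chi> i. Dfi i a" and ?v = "\<chi> i. Dgi i a"
  let ?z = "act ((1/2) *\<^sub>R (x0 + y0)) a" and ?w = "act ((1/2) *\<^sub>R (x1 + y1)) a"
  have "norm (covariance r ?u ?v)
      \<le> seminorm (ip_vec ip) (?u - (\<chi> i. ?z)) * seminorm (ip_vec ip) (?v - (\<chi> i. ?w))"
    by (rule norm_covariance_le[OF r])
  also have "\<dots> \<le> (seminorm ip ((1/2) *\<^sub>R (x0 - y0)) * norm a)
      * (seminorm ip ((1/2) *\<^sub>R (x1 - y1)) * norm a)"
    by (intro mult_mono seminorm_derivative_components_le[OF Df Dfi Df_bound]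
        seminorm_derivative_components_le[OF Dg Dgi Dg_bound]) simp_all
  \<comment> \<open>The constant 1/4 is the product of the halves in the two radii.\<close>
  also have "\<dots> = 1/4 * seminorm ip (x0 - y0) * seminorm ip (x1 - y1) * (norm a)\<^sup>2"
    by (simp add: seminorm_scaleR power2_eq_square)
  finally show "norm ((\<Sum>i\<in>UNIV. r $ i *\<^sub>R ip (Dfi i a) (Dgi i a))
      - ip (\<Sum>i\<in>UNIV. r $ i *\<^sub>R Dfi i a) (\<Sum>i\<in>UNIV. r $ i *\<^sub>R Dgi i a))
      \<le> 1/4 * seminorm ip (x0 - y0) * seminorm ip (x1 - y1) * (norm a)\<^sup>2"
    by (simp add: covariance_def)
qed

end
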